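(* Let $L:\mathbb{R}^d\times\mathbb{R}^d\times\mathbb{R}^d\to\mathbb{R}$, $(x,v,Q)\mapsto L(x,v,Q)$, be of class $C^2$ and such that: $D_xL$ is not identically zero; there is a constant $c>0$ with $D^2_{(x,v)}L\ge cI$ everywhere, where $D^2_{(x,v)}L$ is the Hessian in the pair $(x,v)$; and $c^2>2M^2$, where $M=\max\{\|D^2_{vQ}L\|_{L^\infty},\|D^2_{xQ}L\|_{L^\infty}\}$. Let $g:\mathbb{R}^d\to\mathbb{R}$ be $C^2$ with $D^2g\ge0$. Define the error map on $L^2([0,T],\mathbb{R}^d)$ by $$E[Q](t):=Q(t)+\int_{\mathbb{R}^d}\dot x(t;x_0,Q)\,dm_0(x_0).$$ Then there is $\delta<1$ such that for all $Q_0,Q_1\in L^2([0,T],\mathbb{R}^d)$, $$\langle E[Q_1]-E[Q_0],\,Q_1-Q_0\rangle\ge(1-\delta)\|Q_1-Q_0\|^2,$$ where the inner product and norm are those of $L^2([0,T],\mathbb{R}^d)$.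
   Context: Fix $T>0$ and a probability measure $m_0$ on $\mathbb{R}^d$ (such that $E[Q]$ below is well defined). $L^\infty$ norms of matrix-valued functions are suprema over all $(x,v,Q)$ of the operator norm. For $Q\in L^2([0,T],\mathbb{R}^d)$ and $x_0\in\mathbb{R}^d$, $x(t)=x(t;x_0,Q)$ denotes the unique solution on $[0,T]$ of the Euler–Lagrange system $$\frac{d}{dt}D_vL(x(t),\dot x(t),Q(t))=D_xL(x(t),\dot x(t),Q(t)),\quad x(0)=x_0,\quad D_vL(x(T),\dot x(T),Q(T))=-Dg(x(T)),$$ understood as: $t\mapsto D_vL(x(t),\dot x(t),Q(t))$ is (a.e. equal to) an absolutely continuous function whose derivative is the right-hand side a.e. and whose value at $T$ is $-Dg(x(T))$. A dot denotes $d/dt$. *)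

theory Defs
  imports "HOL-Analysis.Analysis" "HOL-Probability.Probability_Measure"
begin

section \<open>Calculus\<close>

definition C2 :: "('a::real_normed_vector \<Rightarrow> 'b::real_normed_vector) \<Rightarrow> bool" where
  "C2 f \<longleftrightarrow> (\<exists>f' f''.
     (\<forall>x. (f has_derivative blinfun_apply (f' x)) (at x)) \<and>
     (\<forall>x. (f' has_derivative blinfun_apply (f'' x)) (at x)) \<and>
     continuous_on UNIV f'')"

definition gradient :: "('a::real_inner \<Rightarrow> real) \<Rightarrow> 'a \<Rightarrow> 'a" where
  "gradient f x = (THE D. GDERIV f x :> D)"

text \<open>The Hessian is regarded as a linear operator: \<open>h \<bullet> hessian f x k\<close> is the value at
  \<open>(h, k)\<close> of the second derivative.\<close>

definition hessian :: "('a::real_inner \<Rightarrow> real) \<Rightarrow> 'a \<Rightarrow> 'a \<Rightarrow> 'a" where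
  "hessian f x = frechet_derivative (gradient f) (at x)"

text \<open>Absolute continuity on \<open>{a..b}\<close>: \<open>\<D>\<close> ranges over the finite families of
  non-overlapping compact subintervals.\<close>

definition abs_cont_on :: "real \<Rightarrow> real \<Rightarrow> (real \<Rightarrow> 'a::real_normed_vector) \<Rightarrow> bool" where
  "abs_cont_on a b f \<longleftrightarrow> (\<forall>\<epsilon>>0. \<exists>\<delta>>0. \<forall>\<D>.
     \<D> division_of \<Union>\<D> \<and> \<Union>\<D> \<subseteq> {a..b} \<and> (\<Sum>K\<in>\<D>. Sup K - Inf K) < \<delta> \<longrightarrow>
     (\<Sum>K\<in>\<D>. norm (f (Sup K) - f (Inf K))) < \<epsilon>)"

section \<open>The space of square integrable functions on \<open>[0,T]\<close>\<close>

text \<open>Elements are represented by functions; no quotient by a.e. equality is taken, and values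
  outside \<open>{0..T}\<close> are irrelevant.\<close>

definition L2 :: "real \<Rightarrow> (real \<Rightarrow> 'a::euclidean_space) set" where
  "L2 T = {f. f \<in> borel_measurable (lebesgue_on {0..T}) \<and>
              integrable (lebesgue_on {0..T}) (\<lambda>t. (norm (f t))\<^sup>2)}"

definition L2_inner :: "real \<Rightarrow> (real \<Rightarrow> 'a::euclidean_space) \<Rightarrow> (real \<Rightarrow> 'a) \<Rightarrow> real" where
  "L2_inner T f g = (LINT t | lebesgue_on {0..T}. f t \<bullet> g t)"

definition L2_norm :: "real \<Rightarrow> (real \<Rightarrow> 'a::euclidean_space) \<Rightarrow> real" where
  "L2_norm T f = sqrt (L2_inner T f f)"

section \<open>Derivatives of the Lagrangian\<close>

type_synonym 'd lagrangian = "real^'d \<Rightarrow> real^'d \<Rightarrow> real^'d \<Rightarrow> real"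

definition D_x :: "'d::finite lagrangian \<Rightarrow> real^'d \<Rightarrow> real^'d \<Rightarrow> real^'d \<Rightarrow> real^'d" where
  "D_x L x v Q = gradient (\<lambda>y. L y v Q) x"

definition D_v :: "'d::finite lagrangian \<Rightarrow> real^'d \<Rightarrow> real^'d \<Rightarrow> real^'d \<Rightarrow> real^'d" where
  "D_v L x v Q = gradient (\<lambda>w. L x w Q) v"

definition D2_xv ::
    "'d::finite lagrangian \<Rightarrow> real^'d \<Rightarrow> real^'d \<Rightarrow> real^'d \<Rightarrow> (real^'d) \<times> (real^'d) \<Rightarrow> (real^'d) \<times> (real^'d)" where
  "D2_xv L x v Q = hessian (\<lambda>(y, w). L y w Q) (x, v)"

definition D2_xQ :: "'d::finite lagrangian \<Rightarrow> real^'d \<Rightarrow> real^'d \<Rightarrow> real^'d \<Rightarrow> real^'d \<Rightarrow> real^'d" where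
  "D2_xQ L x v Q = frechet_derivative (\<lambda>P. D_x L x v P) (at Q)"

definition D2_vQ :: "'d::finite lagrangian \<Rightarrow> real^'d \<Rightarrow> real^'d \<Rightarrow> real^'d \<Rightarrow> real^'d \<Rightarrow> real^'d" where
  "D2_vQ L x v Q = frechet_derivative (\<lambda>P. D_v L x v P) (at Q)"

text \<open>Supremum of the operator norm over all \<open>(x, v, Q)\<close>; it may be \<open>\<infinity>\<close>.\<close>

definition Linf_norm ::
    "(real^'d \<Rightarrow> real^'d \<Rightarrow> real^'d \<Rightarrow> (real^'d \<Rightarrow> real^'d)) \<Rightarrow> ereal" where
  "Linf_norm A = (SUP (x, v, Q) \<in> UNIV. ereal (onorm (A x v Q)))"

section \<open>The Euler--Lagrange system and the error map\<close>

definition velocity :: "real \<Rightarrow> (real \<Rightarrow> 'a::real_normed_vector) \<Rightarrow> real \<Rightarrow> 'a" where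
  "velocity T x t = vector_derivative x (at t within {0..T})"

text \<open>A solution is an absolutely continuous curve, so that its velocity exists a.e.;
  Lebesgue's differentiation theorem makes the second conjunct automatic. The curve
  \<open>p\<close> is the absolutely continuous version of \<open>D_v L\<close> along the solution. Requiring \<open>x\<close> to be
  extensional fixes its values outside \<open>{0..T}\<close>, so that solutions can be unique as functions.\<close>

definition EL_solution ::
    "real \<Rightarrow> 'd::finite lagrangian \<Rightarrow> (real^'d \<Rightarrow> real) \<Rightarrow> real^'d \<Rightarrow> (real \<Rightarrow> real^'d) \<Rightarrow>
     (real \<Rightarrow> real^'d) \<Rightarrow> bool" where
  "EL_solution T L g x\<^sub>0 Q x \<longleftrightarrow>
     abs_cont_on 0 T x \<and>
     (AE t in lebesgue_on {0..T}. x differentiable (at t within {0..T})) \<and>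
     x \<in> extensional {0..T} \<and>
     x 0 = x\<^sub>0 \<and>
     (\<exists>p. abs_cont_on 0 T p \<and>
          (AE t in lebesgue_on {0..T}. p t = D_v L (x t) (velocity T x t) (Q t)) \<and>
          (AE t in lebesgue_on {0..T}.
             (p has_vector_derivative D_x L (x t) (velocity T x t) (Q t)) (at t within {0..T})) \<and>
          p T = - gradient g (x T))"

definition EL_curve ::
    "real \<Rightarrow> 'd::finite lagrangian \<Rightarrow> (real^'d \<Rightarrow> real) \<Rightarrow> real^'d \<Rightarrow> (real \<Rightarrow> real^'d) \<Rightarrow>
     real \<Rightarrow> real^'d" where
  "EL_curve T L g x\<^sub>0 Q = (THE x. EL_solution T L g x\<^sub>0 Q x)"

definition error_map ::
    "real \<Rightarrow> 'd::finite lagrangian \<Rightarrow> (real^'d \<Rightarrow> real) \<Rightarrow> (real^'d) measure \<Rightarrow>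
     (real \<Rightarrow> real^'d) \<Rightarrow> real \<Rightarrow> real^'d" where
  "error_map T L g m\<^sub>0 Q t = Q t + (LINT x\<^sub>0 | m\<^sub>0. velocity T (EL_curve T L g x\<^sub>0 Q) t)"

text \<open>The curves the error map refers to exist, the integral over the initial positions exists
  for a.e. time, and the result is square integrable. Only existence of the curves is demanded:
  if \<open>L\<close> is strongly convex in \<open>(x, v)\<close> and \<open>g\<close> is convex, uniqueness follows.\<close>

definition error_map_well_defined ::
    "real \<Rightarrow> 'd::finite lagrangian \<Rightarrow> (real^'d \<Rightarrow> real) \<Rightarrow> (real^'d) measure \<Rightarrow> bool" where
  "error_map_well_defined T L g m\<^sub>0 \<longleftrightarrow> (\<forall>Q\<in>L2 T.
     (\<forall>x\<^sub>0. \<exists>x. EL_solution T L g x\<^sub>0 Q x) \<and>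
     (AE t in lebesgue_on {0..T}. integrable m\<^sub>0 (\<lambda>x\<^sub>0. velocity T (EL_curve T L g x\<^sub>0 Q) t)) \<and>
     error_map T L g m\<^sub>0 Q \<in> L2 T)"

end

theory Submission
  imports Defs
begin

text \<open>
  Let \<open>(x0, p0)\<close> and \<open>(x1, p1)\<close> solve the Hamiltonian form of the system for \<open>Q0\<close>, \<open>Q1\<close> and put
  \<open>y = x1 - x0\<close>, \<open>q = p1 - p0\<close>. Then \<open>q \<bullet> y\<close> is absolutely continuous, its terminal value is
  nonpositive because \<open>g\<close> is convex, and by strong convexity of \<open>L\<close> its derivative is at least
  \<open>c / 2 * (|y|\<^sup>2 + |y'|\<^sup>2) - M\<^sup>2 / c * |Q1 - Q0|\<^sup>2\<close>. Integrating with \<open>y 0 = 0\<close> gives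
  \<open>\<parallel>y'\<parallel>\<^sup>2 \<le> \<kappa> * \<parallel>Q1 - Q0\<parallel>\<^sup>2\<close> with \<open>\<kappa> = 2 * M\<^sup>2 / c\<^sup>2 < 1\<close>, for every initial point; averaging
  over the initial points by Fubini's theorem yields the claim with \<open>\<delta> = (1 + \<kappa>) / 2\<close>.
  Fubini needs joint measurability of the velocity in time and initial point. The same
  integration for equal \<open>Q\<close> but different initial points shows that the curves depend
  continuously on the initial point, from which joint measurability follows.
\<close>

section \<open>Absolutely continuous functions\<close>

lemma abs_cont_onE:
  assumes "abs_cont_on a b f" "\<epsilon> > 0"
  obtains \<delta> where "\<delta> > 0" "\<And>\<D>. \<D> division_of \<Union>\<D> \<Longrightarrow> \<Union>\<D> \<subseteq> {a..b} \<Longrightarrow>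
     (\<Sum>K\<in>\<D>. Sup K - Inf K) < \<delta> \<Longrightarrow> (\<Sum>K\<in>\<D>. norm (f (Sup K) - f (Inf K))) < \<epsilon>"
proof -
  from assms(1)[unfolded abs_cont_on_def, rule_format, OF assms(2)]
  show thesis using that by blast
qed

lemma abs_cont_on_dist:
  assumes "abs_cont_on a b f" "\<epsilon> > 0"
  obtains \<delta> where "\<delta> > 0" "\<And>s t. s \<in> {a..b} \<Longrightarrow> t \<in> {a..b} \<Longrightarrow> \<bar>t - s\<bar> < \<delta> \<Longrightarrow> norm (f t - f s) < \<epsilon>"
proof -
  obtain \<delta> where \<delta>: "\<delta> > 0" "\<And>\<D>. \<D> division_of \<Union>\<D> \<Longrightarrow> \<Union>\<D> \<subseteq> {a..b} \<Longrightarrow>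
     (\<Sum>K\<in>\<D>. Sup K - Inf K) < \<delta> \<Longrightarrow> (\<Sum>K\<in>\<D>. norm (f (Sup K) - f (Inf K))) < \<epsilon>"
    using abs_cont_onE[OF assms] by blast
  \<comment> \<open>The family consisting of the single interval \<open>cbox s t\<close> is
    admissible; the ordering of \<open>s\<close> and \<open>t\<close> is removed afterwards by
    symmetry.\<close>
  have *: "norm (f t - f s) < \<epsilon>" if "s \<in> {a..b}" "t \<in> {a..b}" "s \<le> t" "t - s < \<delta>" for s t
    using \<delta>(2)[of "{cbox s t}"] division_of_self[of s t] that by auto
  show thesis
  proof
    show "norm (f t - f s) < \<epsilon>" if "s \<in> {a..b}" "t \<in> {a..b}" "\<bar>t - s\<bar> < \<delta>" for s t
      using *[of s t] *[of t s] that by (cases "s \<le> t") (auto simp: norm_minus_commute)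
  qed (fact \<delta>(1))
qed

lemma abs_cont_on_imp_continuous_on:
  assumes "abs_cont_on a b f"
  shows "continuous_on {a..b} f"
  unfolding continuous_on_iff dist_norm real_norm_def
  by (metis abs_cont_on_dist assms)

lemma abs_cont_on_imp_bounded:
  assumes "abs_cont_on a b f"
  obtains B where "B > 0" "\<And>t. t \<in> {a..b} \<Longrightarrow> norm (f t) \<le> B"
proof -
  have "bounded (f ` {a..b})"
    by (intro compact_imp_bounded compact_continuous_image abs_cont_on_imp_continuous_on assms compact_Icc)
  then show thesis
    using that unfolding bounded_pos by auto
qed

lemma abs_cont_on_subset:
  assumes "abs_cont_on a b f" "{c..d} \<subseteq> {a..b}"
  shows "abs_cont_on c d f"
  using assms unfolding abs_cont_on_def by (meson order_trans)

text \<open>Common source of the closure properties below. The hypothesis is used only at the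
  endpoints of the intervals, so summing it over a family bounds the total increment of
  \<open>h\<close> by those of \<open>f\<close> and \<open>g\<close>. Each of these gets the
  tolerance \<open>\<epsilon> / (2 * B)\<close>.\<close>

lemma abs_cont_on_bound:
  fixes f :: "real \<Rightarrow> 'a::real_normed_vector" and g :: "real \<Rightarrow> 'b::real_normed_vector"
    and h :: "real \<Rightarrow> 'c::real_normed_vector"
  assumes f: "abs_cont_on a b f" and g: "abs_cont_on a b g" and "B > 0"
    and le: "\<And>s t. s \<in> {a..b} \<Longrightarrow> t \<in> {a..b} \<Longrightarrow>
      norm (h t - h s) \<le> B * (norm (f t - f s) + norm (g t - g s))"
  shows "abs_cont_on a b h"
  unfolding abs_cont_on_def
proof (intro allI impI)
  fix \<epsilon> :: real assume "\<epsilon> > 0"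
  then have e: "\<epsilon> / (2 * B) > 0" using \<open>B > 0\<close> by simp
  obtain \<delta>1 where d1: "\<delta>1 > 0" "\<And>\<D>. \<D> division_of \<Union>\<D> \<Longrightarrow> \<Union>\<D> \<subseteq> {a..b} \<Longrightarrow>
     (\<Sum>K\<in>\<D>. Sup K - Inf K) < \<delta>1 \<Longrightarrow> (\<Sum>K\<in>\<D>. norm (f (Sup K) - f (Inf K))) < \<epsilon> / (2 * B)"
    using abs_cont_onE[OF f e] by blast
  obtain \<delta>2 where d2: "\<delta>2 > 0" "\<And>\<D>. \<D> division_of \<Union>\<D> \<Longrightarrow> \<Union>\<D> \<subseteq> {a..b} \<Longrightarrow>
     (\<Sum>K\<in>\<D>. Sup K - Inf K) < \<delta>2 \<Longrightarrow> (\<Sum>K\<in>\<D>. norm (g (Sup K) - g (Inf K))) < \<epsilon> / (2 * B)"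
    using abs_cont_onE[OF g e] by blast
  show "\<exists>\<delta>>0. \<forall>\<D>. \<D> division_of \<Union>\<D> \<and> \<Union>\<D> \<subseteq> {a..b} \<and> (\<Sum>K\<in>\<D>. Sup K - Inf K) < \<delta> \<longrightarrow>
      (\<Sum>K\<in>\<D>. norm (h (Sup K) - h (Inf K))) < \<epsilon>"
  proof (intro exI[of _ "min \<delta>1 \<delta>2"] conjI allI impI)
    fix \<D> :: "real set set"
    assume D: "\<D> division_of \<Union>\<D> \<and> \<Union>\<D> \<subseteq> {a..b} \<and> (\<Sum>K\<in>\<D>. Sup K - Inf K) < min \<delta>1 \<delta>2"
    have "(\<Sum>K\<in>\<D>. norm (h (Sup K) - h (Inf K)))
        \<le> (\<Sum>K\<in>\<D>. B * (norm (f (Sup K) - f (Inf K)) + norm (g (Sup K) - g (Inf K))))"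
    proof (intro sum_mono le)
      fix K assume "K \<in> \<D>"
      then have "K \<noteq> {}" "K \<subseteq> {a..b}" "\<exists>u v. K = cbox u v" using D division_ofD(3,4)[of \<D> "\<Union>\<D>" K] by auto
      then show "Sup K \<in> {a..b}" "Inf K \<in> {a..b}" by auto
    qed
    also have "\<dots> = B * ((\<Sum>K\<in>\<D>. norm (f (Sup K) - f (Inf K))) + (\<Sum>K\<in>\<D>. norm (g (Sup K) - g (Inf K))))"
      by (simp add: sum_distrib_left sum.distrib algebra_simps)
    also have "\<dots> < B * (\<epsilon> / (2 * B) + \<epsilon> / (2 * B))"
      using d1(2)[of \<D>] d2(2)[of \<D>] D \<open>B > 0\<close> by (intro mult_strict_left_mono add_strict_mono) auto
    also have "\<dots> = \<epsilon>" using \<open>B > 0\<close> by simp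
    finally show "(\<Sum>K\<in>\<D>. norm (h (Sup K) - h (Inf K))) < \<epsilon>" .
  qed (use d1 d2 in auto)
qed

lemma abs_cont_on_diff:
  assumes "abs_cont_on a b f" "abs_cont_on a b g"
  shows "abs_cont_on a b (\<lambda>t. f t - g t)"
proof (rule abs_cont_on_bound[OF assms, of 1])
  show "norm ((f t - g t) - (f s - g s)) \<le> 1 * (norm (f t - f s) + norm (g t - g s))" for s t
    using norm_triangle_ineq4[of "f t - f s" "g t - g s"] by (simp add: algebra_simps)
qed simp

text \<open>Product rule for increments; both factors are bounded because they are continuous on a
  compact interval.\<close>

lemma abs_cont_on_inner:
  fixes f g :: "real \<Rightarrow> 'a::real_inner"
  assumes f: "abs_cont_on a b f" and g: "abs_cont_on a b g"
  shows "abs_cont_on a b (\<lambda>t. f t \<bullet> g t)"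
proof -
  obtain B where B: "B > 0" "\<And>t. t \<in> {a..b} \<Longrightarrow> norm (f t) \<le> B"
    using abs_cont_on_imp_bounded[OF f] by blast
  obtain C where C: "C > 0" "\<And>t. t \<in> {a..b} \<Longrightarrow> norm (g t) \<le> C"
    using abs_cont_on_imp_bounded[OF g] by blast
  show ?thesis
  proof (rule abs_cont_on_bound[OF f g])
    fix s t assume st: "s \<in> {a..b}" "t \<in> {a..b}"
    have "f t \<bullet> g t - f s \<bullet> g s = (f t - f s) \<bullet> g t + f s \<bullet> (g t - g s)"
      by (simp add: inner_diff)
    also have "norm \<dots> \<le> norm (f t - f s) * norm (g t) + norm (f s) * norm (g t - g s)"
      by (intro norm_triangle_le add_mono) (auto simp: Cauchy_Schwarz_ineq2)
    also have "\<dots> \<le> norm (f t - f s) * (B + C) + (B + C) * norm (g t - g s)"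
      using B C st by (intro add_mono mult_left_mono mult_right_mono) (auto intro: add_increasing add_increasing2 less_imp_le)
    finally show "norm (f t \<bullet> g t - f s \<bullet> g s) \<le> (B + C) * (norm (f t - f s) + norm (g t - g s))"
      by (simp add: algebra_simps)
  qed (use B C in auto)
qed

text \<open>Gauge-integral proof: tags outside \<open>N\<close> are treated as in the usual fundamental theorem; the
  intervals tagged in \<open>N\<close> lie in an open set of small measure, where absolute continuity
  controls the increments of \<open>f\<close>. Integrability of \<open>f'\<close> is thus a conclusion, not an assumption.\<close>

lemma abs_cont_on_has_integral:
  fixes f :: "real \<Rightarrow> 'a::banach"
  assumes "a \<le> b" and ac: "abs_cont_on a b f" and N: "negligible N"
    and vecd: "\<And>x. x \<in> {a..b} - N \<Longrightarrow> (f has_vector_derivative f' x) (at x within {a..b})"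
  shows "(f' has_integral (f b - f a)) {a..b}"
proof (cases "a = b")
  case True
  then show ?thesis by (simp add: has_integral_refl)
next
  case False
  with \<open>a \<le> b\<close> have "a < b" by simp
  \<comment> \<open>Changing the integrand to 0 on the null set \<open>N\<close> leaves the integral
    unchanged. A tag in \<open>N\<close> then contributes nothing but an increment of
    \<open>f\<close>.\<close>
  define g where "g x = (if x \<in> N then 0 else f' x)" for x
  have "(g has_integral (f b - f a)) {a..b}"
    unfolding has_integral_factor_content box_real[symmetric]
  proof safe
    fix e0 :: real
    assume "e0 > 0"
    \<comment> \<open>The tags inside \<open>N\<close> and those outside \<open>N\<close> each cause
      an error of at most \<open>e * (b - a)\<close>.\<close>
    define e where "e = e0 / 2"
    have "e > 0" using \<open>e0 > 0\<close> by (simp add: e_def)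
    have "\<forall>x. \<exists>d>0. x \<in> {a..b} - N \<longrightarrow>
         (\<forall>y\<in>{a..b}. norm (y-x) < d \<longrightarrow> norm (f y - f x - (y-x) *\<^sub>R f' x) \<le> e * norm (y-x))"
      using vecd[unfolded has_vector_derivative_def has_derivative_within_alt] \<open>e > 0\<close>
      by (metis zero_less_one)
    then obtain d where d: "\<And>x. 0 < d x"
                 "\<And>x y. \<lbrakk>x \<in> {a..b} - N; y \<in> {a..b}; norm (y-x) < d x\<rbrakk>
                        \<Longrightarrow> norm (f y - f x - (y-x) *\<^sub>R f' x) \<le> e * norm (y-x)"
      by metis
    have "e * (b - a) > 0" using \<open>e > 0\<close> \<open>a < b\<close> by simp
    then obtain \<delta> where \<delta>: "\<delta> > 0" "\<And>\<D>. \<D> division_of \<Union>\<D> \<Longrightarrow> \<Union>\<D> \<subseteq> {a..b} \<Longrightarrow>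
       (\<Sum>K\<in>\<D>. Sup K - Inf K) < \<delta> \<Longrightarrow> (\<Sum>K\<in>\<D>. norm (f (Sup K) - f (Inf K))) < e * (b - a)"
      using abs_cont_onE[OF ac] by blast
    have Nl: "N \<in> sets lebesgue" "emeasure lebesgue N = 0"
      using N negligible_iff_null_sets null_setsD1 null_setsD2 by blast+
    obtain U where U: "open U" "N \<subseteq> U" "U - N \<in> lmeasurable" "emeasure lebesgue (U - N) < ennreal \<delta>"
      using sets_lebesgue_outer_open[OF Nl(1) \<delta>(1)] by metis
    have emU: "emeasure lebesgue U < ennreal \<delta>"
    proof -
      have "U = (U - N) \<union> N" using U(2) by blast
      then have "emeasure lebesgue U \<le> emeasure lebesgue (U - N) + emeasure lebesgue N"
        using emeasure_subadditive[OF fmeasurableD[OF U(3)] Nl(1)] by simp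
      then show ?thesis using U(4) Nl(2) by simp
    qed
    have "\<forall>x. \<exists>r>0. x \<in> N \<longrightarrow> ball x r \<subseteq> U"
      using U(1,2) by (metis open_contains_ball subsetD zero_less_one)
    then obtain r where r: "\<And>x. 0 < r x" "\<And>x. x \<in> N \<Longrightarrow> ball x (r x) \<subseteq> U" by metis
    define \<rho> where "\<rho> x = min (d x) (r x)" for x
    show "\<exists>d. gauge d \<and> (\<forall>p. p tagged_division_of (cbox a b) \<and> d fine p \<longrightarrow>
      norm ((\<Sum>(x, k)\<in>p. measure lborel k *\<^sub>R g x) - (f b - f a)) \<le> e0 * measure lborel (cbox a b))"
    proof (rule exI, safe)
      show "gauge (\<lambda>x. ball x (\<rho> x))"
        using d(1) r(1) by (intro gauge_ball_dependent) (simp add: \<rho>_def)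
    next
      fix p
      assume ptag: "p tagged_division_of cbox a b" and finep: "(\<lambda>x. ball x (\<rho> x)) fine p"
      have finp: "finite p" using ptag by blast
      define p1 where "p1 = {(x,K)\<in>p. x \<in> N}"
      define p2 where "p2 = {(x,K)\<in>p. x \<notin> N}"
      have "p1 \<subseteq> p" "p2 \<subseteq> p" by (auto simp: p1_def p2_def)
      then have "finite p1" "finite p2" using finp by (auto intro: finite_subset)
      with \<open>p1 \<subseteq> p\<close> \<open>p2 \<subseteq> p\<close> have pp: "p = p1 \<union> p2" "p1 \<inter> p2 = {}" "finite p1" "finite p2" "p1 \<subseteq> p" "p2 \<subseteq> p"
        by (auto simp: p1_def p2_def)
      have ba: "b - a = (\<Sum>(x,K)\<in>p. Sup K - Inf K)" "f b - f a = (\<Sum>(x,K)\<in>p. f(Sup K) - f(Inf K))"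
        using additive_tagged_division_1[where f= "\<lambda>x. x"] additive_tagged_division_1[where f= f]
            \<open>a \<le> b\<close> ptag by auto
      have ord: "Inf K \<le> Sup K" if "(x,K) \<in> p" for x K
      proof -
        have "x \<in> K" "\<exists>u v. K = cbox u v" using ptag that by blast+
        then show ?thesis by auto
      qed
      have B2: "norm (\<Sum>(x, K) \<in> p2. (measure lborel K *\<^sub>R g x) - (f (Sup K) - f (Inf K)))
          \<le> (\<Sum>n\<in>p2. e * (case n of (x, k) \<Rightarrow> Sup k - Inf k))"
      proof (rule sum_norm_le,safe)
        fix x K
        assume xK: "(x, K) \<in> p2"
        then have "(x, K) \<in> p" "x \<notin> N" by (auto simp: p2_def)
        then have "x \<in> K" and kab: "K \<subseteq> cbox a b"
          using ptag by blast+
        then obtain u v where k: "K = cbox u v" and "x \<in> K" and kab: "K \<subseteq> cbox a b"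
          using ptag \<open>(x, K) \<in> p\<close> by auto 
        have "u \<le> v"
          using \<open>x \<in> K\<close> unfolding k by auto
        have ball: "\<forall>y\<in>K. y \<in> ball x (d x)"
          using finep \<open>(x, K) \<in> p\<close> by (force simp: \<rho>_def fine_def)
        have "u \<in> K" "v \<in> K"
          by (simp_all add: \<open>u \<le> v\<close> k)
        have "norm ((v - u) *\<^sub>R f' x - (f v - f u)) = norm (f u - f x - (u - x) *\<^sub>R f' x - (f v - f x - (v - x) *\<^sub>R f' x))"
          by (auto simp: algebra_simps)
        also have "\<dots> \<le> norm (f u - f x - (u - x) *\<^sub>R f' x) + norm (f v - f x - (v - x) *\<^sub>R f' x)"
          by (rule norm_triangle_ineq4)
        also have "\<dots> \<le> e * norm (u - x) + e * norm (v - x)"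
          by (intro add_mono d(2); use \<open>x \<in> K\<close> \<open>x \<notin> N\<close> kab \<open>u \<in> K\<close> \<open>v \<in> K\<close> ball in \<open>auto simp: dist_norm norm_minus_commute\<close>)
        also have "\<dots> = e * (v - u)"
          using \<open>x \<in> K\<close> unfolding k by (auto simp: algebra_simps)
        finally show "norm (measure lborel K *\<^sub>R g x - (f (Sup K) - f (Inf K))) \<le> e * (Sup K - Inf K)"
          using \<open>u \<le> v\<close> \<open>x \<notin> N\<close> by (simp add: k g_def)
      qed
      also have "\<dots> \<le> (\<Sum>n\<in>p. e * (case n of (x, k) \<Rightarrow> Sup k - Inf k))"
      proof (rule sum_mono2[OF finp pp(6)])
        fix n assume "n \<in> p - p2"
        then show "0 \<le> e * (case n of (x, k) \<Rightarrow> Sup k - Inf k)"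
          using ord[of "fst n" "snd n"] \<open>e > 0\<close> by (simp add: split_beta)
      qed
      also have "\<dots> = e * (b - a)"
        unfolding ba(1) by (simp add: sum_distrib_left)
      finally have B2': "norm (\<Sum>(x, K) \<in> p2. (measure lborel K *\<^sub>R g x) - (f (Sup K) - f (Inf K))) \<le> e * (b - a)" .
      have tpart: "p1 tagged_partial_division_of cbox a b"
        using tagged_partial_division_subset[OF _ pp(5)] ptag unfolding tagged_division_of_def by auto
      define \<D> where "\<D> = snd ` p1"
      have div: "\<D> division_of \<Union>\<D>"
        unfolding \<D>_def by (rule partial_division_of_tagged_division[OF tpart])
      have tdiv: "p1 tagged_division_of \<Union>\<D>"
        unfolding \<D>_def by (rule tagged_partial_division_of_Union_self[OF tpart])
      have sub: "K \<subseteq> {a..b} \<inter> U" if K: "K \<in> \<D>" for K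
      proof -
        obtain x where x: "(x, K) \<in> p" "x \<in> N"
          using K by (auto simp: \<D>_def p1_def)
        have "K \<subseteq> cbox a b"
          using tagged_division_ofD(3)[OF ptag x(1)] .
        moreover have "K \<subseteq> ball x (r x)"
          using fineD[OF finep x(1)] by (auto simp: \<rho>_def)
        ultimately show ?thesis
          using r(2)[OF x(2)] by auto
      qed
      then have subab: "\<Union>\<D> \<subseteq> {a..b}" and subU: "\<Union>\<D> \<subseteq> U"
        by blast+
      have len: "(\<Sum>K\<in>\<D>. Sup K - Inf K) < \<delta>"
      proof -
        have "(\<Sum>K\<in>\<D>. Sup K - Inf K) = (\<Sum>K\<in>\<D>. measure lebesgue K)"
        proof (intro sum.cong refl)
          fix K assume "K \<in> \<D>"
          then have "K \<noteq> {}" "\<exists>u v. K = cbox u v" using division_ofD(3,4)[OF div] by auto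
          then show "Sup K - Inf K = measure lebesgue K" by auto
        qed
        also have "\<dots> = measure lebesgue (\<Union>\<D>)" by (rule content_division[OF div])
        also have "\<dots> \<le> measure lebesgue U"
        proof (rule measure_mono_fmeasurable[OF subU])
          show "\<Union>\<D> \<in> sets lebesgue" using lmeasurable_division[OF div] by blast
          show "U \<in> lmeasurable" using emU U(1)
            by (intro fmeasurableI) (auto intro: order_less_trans[OF _ ennreal_less_top])
        qed
        also have "\<dots> < \<delta>"
          using enn2real_mono[of "emeasure lebesgue U"] emU \<delta>(1)
          unfolding measure_def by (subst enn2real_less_iff) (auto intro: order_less_trans)
        finally show ?thesis .
      qed
      have "norm (\<Sum>(x, K) \<in> p1. (measure lborel K *\<^sub>R g x) - (f (Sup K) - f (Inf K)))
          \<le> (\<Sum>(x,K)\<in>p1. norm (f (Sup K) - f (Inf K)))"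
        by (rule sum_norm_le) (auto simp: p1_def g_def norm_minus_commute)
      \<comment> \<open>The passage from tagged intervals to intervals requires a summand that
        vanishes on every box with empty interior. The guard covers the empty box, whose
        \<open>Sup\<close> and \<open>Inf\<close> are unspecified.\<close>
      also have "\<dots> = (\<Sum>(x,K)\<in>p1. if K = {} then 0 else norm (f (Sup K) - f (Inf K)))"
        by (intro sum.cong) (auto dest: tagged_division_ofD(2)[OF tdiv])
      also have "\<dots> = (\<Sum>K\<in>\<D>. if K = {} then 0 else norm (f (Sup K) - f (Inf K)))"
        unfolding \<D>_def
      proof (rule sum.over_tagged_division_lemma[OF tdiv])
        fix u v :: real assume "box u v = {}"
        then consider "v < u" | "v = u" by (force simp: box_eq_empty)
        then show "(if cbox u v = {} then 0 else norm (f (Sup (cbox u v)) - f (Inf (cbox u v)))) = 0"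
          by cases auto
      qed
      also have "\<dots> = (\<Sum>K\<in>\<D>. norm (f (Sup K) - f (Inf K)))"
        using division_ofD(3)[OF div] by (intro sum.cong) auto
      also have "\<dots> < e * (b - a)"
        by (rule \<delta>(2)[OF div subab len])
      finally have B1: "norm (\<Sum>(x, K) \<in> p1. (measure lborel K *\<^sub>R g x) - (f (Sup K) - f (Inf K))) \<le> e * (b - a)"
        by simp
      have "(\<Sum>(x, k)\<in>p. measure lborel k *\<^sub>R g x) - (f b - f a) =
         (\<Sum>(x, K) \<in> p1. (measure lborel K *\<^sub>R g x) - (f (Sup K) - f (Inf K))) +
         (\<Sum>(x, K) \<in> p2. (measure lborel K *\<^sub>R g x) - (f (Sup K) - f (Inf K)))"
        unfolding ba(2) sum_subtractf[symmetric]
        using pp by (simp add: sum.union_disjoint split_def)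
      also have "norm \<dots> \<le> e * (b - a) + e * (b - a)"
        using B1 B2' by (intro norm_triangle_le add_mono)
      also have "\<dots> = e0 * measure lborel (cbox a b)"
        using \<open>a \<le> b\<close> by (simp add: e_def)
      finally show "norm ((\<Sum>(x, k)\<in>p. measure lborel k *\<^sub>R g x) - (f b - f a)) \<le> e0 * measure lborel (cbox a b)" .
    qed
  qed
  then show ?thesis
    by (rule has_integral_spike[OF N, rotated]) (auto simp: g_def)
qed

section \<open>Almost-everywhere statements and comparison of Lebesgue with gauge integrals\<close>

lemma AE_lebesgue_on_negligibleE:
  assumes "AE t in lebesgue_on S. P t" "S \<in> sets lebesgue"
  obtains N where "negligible N" "\<And>t. t \<in> S - N \<Longrightarrow> P t"
proof -
  have "AE t in lebesgue. t \<in> S \<longrightarrow> P t"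
    using assms by (simp add: AE_restrict_space_iff)
  then obtain N where "N \<in> null_sets lebesgue" "{t. \<not> (t \<in> S \<longrightarrow> P t)} \<subseteq> N"
    unfolding eventually_ae_filter by auto
  then show thesis
    by (intro that[of N]) (auto simp: negligible_iff_null_sets)
qed

lemma AE_lebesgue_on_negligibleI:
  assumes "negligible N" "\<And>t. t \<in> S - N \<Longrightarrow> P t" "S \<in> sets lebesgue"
  shows "AE t in lebesgue_on S. P t"
proof -
  have "AE t in lebesgue. t \<in> S \<longrightarrow> P t"
    using assms(1,2) by (intro AE_I'[of N]) (auto simp: negligible_iff_null_sets)
  then show ?thesis
    using assms(3) by (simp add: AE_restrict_space_iff)
qed

lemma abs_cont_on_has_integral_AE:
  fixes f :: "real \<Rightarrow> 'a::banach"
  assumes "a \<le> b" "abs_cont_on a b f"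
    and "AE t in lebesgue_on {a..b}. (f has_vector_derivative f' t) (at t within {a..b})"
  shows "(f' has_integral (f b - f a)) {a..b}"
proof -
  obtain N where "negligible N"
    "\<And>t. t \<in> {a..b} - N \<Longrightarrow> (f has_vector_derivative f' t) (at t within {a..b})"
    using AE_lebesgue_on_negligibleE[OF assms(3)] by auto
  with assms(1,2) show ?thesis
    by (intro abs_cont_on_has_integral)
qed

text \<open>In the energy estimate the upper bound \<open>g\<close> is known only to be gauge
  integrable, because it contains the derivative of an absolutely continuous function. Domination of
  a nonnegative measurable \<open>f\<close> still makes \<open>f\<close> gauge integrable, and for
  nonnegative functions this is Lebesgue integrability. Both functions are set to 0 on the
  exceptional null set so that the inequality holds everywhere.\<close>

lemma integrable_AE_le_has_integral:
  fixes f g :: "real \<Rightarrow> real"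
  assumes S: "S \<in> sets lebesgue" and f: "f \<in> borel_measurable (lebesgue_on S)" "\<And>t. 0 \<le> f t"
    and le: "AE t in lebesgue_on S. f t \<le> g t" and g: "(g has_integral K) S"
  shows "integrable (lebesgue_on S) f" "(LINT t | lebesgue_on S. f t) \<le> K"
proof -
  obtain N where N: "negligible N" "\<And>t. t \<in> S - N \<Longrightarrow> f t \<le> g t"
    using AE_lebesgue_on_negligibleE[OF le S] by auto
  define f0 where "f0 t = (if t \<in> N then 0 else f t)" for t
  define g0 where "g0 t = (if t \<in> N then 0 else g t)" for t
  have ae: "AE t in lebesgue_on S. f t = f0 t"
    using N(1) S by (intro AE_lebesgue_on_negligibleI[of N]) (auto simp: f0_def)
  have Nl: "N \<in> sets lebesgue"
    using N(1) negligible_iff_null_sets null_setsD2 by blast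
  have "{t \<in> space (lebesgue_on S). t \<in> N} \<in> sets (lebesgue_on S)"
    using Nl S by (auto simp: sets_restrict_space space_restrict_space image_iff Collect_conj_eq Int_commute)
  then have f0m: "f0 \<in> borel_measurable (lebesgue_on S)"
    unfolding f0_def using f(1) by (intro measurable_If) auto
  have g0: "(g0 has_integral K) S"
    by (rule has_integral_spike[OF N(1) _ g]) (auto simp: g0_def)
  have le0: "f0 t \<le> g0 t" "0 \<le> f0 t" if "t \<in> S" for t
    using N(2)[of t] f(2)[of t] that by (auto simp: f0_def g0_def)
  have "f0 integrable_on S"
    using f0m g0 le0 S by (intro measurable_bounded_by_integrable_imp_integrable_real[of f0 S g0]) auto
  then have "f0 absolutely_integrable_on S"
    using le0 by (intro nonnegative_absolutely_integrable_1)
  then have f0i: "integrable (lebesgue_on S) f0"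
    using S by (rule absolutely_integrable_imp_integrable)
  then show "integrable (lebesgue_on S) f"
    using integrable_cong_AE[OF f(1) f0m ae] by simp
  have "(LINT t | lebesgue_on S. f t) = (LINT t | lebesgue_on S. f0 t)"
    by (rule integral_cong_AE[OF f(1) f0m ae])
  also have "\<dots> \<le> K"
    by (rule has_integral_le[OF has_integral_integral_lebesgue_on[OF f0i S] g0 le0(1)])
  finally show "(LINT t | lebesgue_on S. f t) \<le> K" .
qed

section \<open>Gradients and bounds on the Lagrangian\<close>

lemma gradient_eq:
  assumes "GDERIV f x :> D"
  shows "gradient f x = D"
  unfolding gradient_def
proof (rule the_equality)
  fix D' assume "GDERIV f x :> D'"
  then have "(\<lambda>h. h \<bullet> D') = (\<lambda>h. h \<bullet> D)"
    using assms unfolding gderiv_def by (rule has_derivative_unique)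
  then have "\<forall>h. h \<bullet> D' = h \<bullet> D"
    by (simp add: fun_eq_iff)
  then show "D' = D"
    by (simp only: vector_eq_ldot)
qed (fact assms)

text \<open>The gradient is the Riesz representative \<open>G\<close> of the derivative. It depends
  linearly on the derivative, so its differentiability is inherited from the second
  derivative.\<close>

lemma C2_gradient:
  fixes f :: "'a::euclidean_space \<Rightarrow> real"
  assumes "C2 f"
  shows "GDERIV f x :> gradient f x" "gradient f differentiable at x"
proof -
  obtain f' f'' where f': "\<And>x. (f has_derivative blinfun_apply (f' x)) (at x)"
    and f'': "\<And>x. (f' has_derivative blinfun_apply (f'' x)) (at x)"
    using assms unfolding C2_def by blast
  define G where "G x = (\<Sum>b\<in>Basis. f' x b *\<^sub>R b)" for x
  have app: "blinfun_apply (f' x) h = h \<bullet> G x" for x h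
  proof -
    have "blinfun_apply (f' x) h = blinfun_apply (f' x) (\<Sum>b\<in>Basis. (h \<bullet> b) *\<^sub>R b)"
      by (simp add: euclidean_representation)
    also have "\<dots> = h \<bullet> G x"
      unfolding G_def by (simp add: blinfun.sum_right blinfun.scaleR_right inner_sum_right mult.commute)
    finally show ?thesis .
  qed
  then have "blinfun_apply (f' x) = (\<lambda>h. h \<bullet> G x)" for x
    by (intro ext)
  then have G: "GDERIV f x :> G x" for x
    using f'[of x] by (simp only: gderiv_def)
  then have eq: "gradient f = G"
    by (intro ext gradient_eq)
  show "GDERIV f x :> gradient f x"
    using G eq by simp
  have "(G has_derivative (\<lambda>h. \<Sum>b\<in>Basis. f'' x h b *\<^sub>R b)) (at x)"
    unfolding G_def
    by (rule has_derivative_sum has_derivative_scaleR_left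
        bounded_linear.has_derivative[OF blinfun.bounded_linear_left] f'')+
  then show "gradient f differentiable at x"
    unfolding eq by (rule differentiableI)
qed

text \<open>Mean value theorem for the component of the gradient along the segment from
  \<open>y\<close> to \<open>x\<close>: the derivative of \<open>\<phi>\<close> is the Hessian
  quadratic form in the direction \<open>h\<close>.\<close>

lemma inner_gradient_diff_ge:
  fixes f :: "'a::euclidean_space \<Rightarrow> real"
  assumes diff: "\<And>x. gradient f differentiable at x"
    and hess: "\<And>x h. h \<bullet> hessian f x h \<ge> c * (h \<bullet> h)"
  shows "(gradient f x - gradient f y) \<bullet> (x - y) \<ge> c * (norm (x - y))\<^sup>2"
proof -
  define h where "h = x - y"
  define \<phi> where "\<phi> s = gradient f (y + s *\<^sub>R h) \<bullet> h" for s :: real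
  have d: "(gradient f has_derivative hessian f z) (at z)" for z
    unfolding hessian_def using diff[of z] by (simp add: frechet_derivative_works)
  have "(\<phi> has_real_derivative (h \<bullet> hessian f (y + s *\<^sub>R h) h)) (at s)" for s
  proof -
    have lin: "linear (hessian f (y + s *\<^sub>R h))"
      using d has_derivative_linear by blast
    have "((\<lambda>s. y + s *\<^sub>R h) has_derivative (\<lambda>t. t *\<^sub>R h)) (at s)"
      by (auto intro!: derivative_eq_intros)
    from has_derivative_compose[OF this d]
    have "((\<lambda>s. gradient f (y + s *\<^sub>R h)) has_derivative (\<lambda>t. hessian f (y + s *\<^sub>R h) (t *\<^sub>R h))) (at s)" .
    from has_derivative_inner_left[OF this, of h]
    have "(\<phi> has_derivative (\<lambda>t. hessian f (y + s *\<^sub>R h) (t *\<^sub>R h) \<bullet> h)) (at s)"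
      by (simp add: \<phi>_def[abs_def])
    then show ?thesis
      unfolding has_field_derivative_def
      by (rule has_derivative_eq_rhs) (auto simp: linear_cmul[OF lin] inner_commute)
  qed
  then obtain s where "\<phi> 1 - \<phi> 0 = (1 - 0) * (h \<bullet> hessian f (y + s *\<^sub>R h) h)"
    using MVT2[of 0 1 \<phi> "\<lambda>s. h \<bullet> hessian f (y + s *\<^sub>R h) h"] zero_less_one by blast
  then have "\<phi> 1 - \<phi> 0 \<ge> c * (h \<bullet> h)"
    using hess by simp
  then show ?thesis
    by (simp add: \<phi>_def h_def power2_norm_eq_inner inner_diff_left)
qed

text \<open>By the chain rule along the affine embeddings of the slices, all partial gradients are
  blocks of the full gradient \<open>A\<close>, and differentiability of \<open>A\<close> carries
  over to them. Hence \<open>D2_xQ\<close>, \<open>D2_vQ\<close> and \<open>D2_xv\<close> are true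
  derivatives here and not default values of \<open>frechet_derivative\<close>.\<close>

lemma
  fixes L :: "'d::finite lagrangian"
  assumes "C2 (\<lambda>(x, v, Q). L x v Q)"
  defines "A \<equiv> gradient (\<lambda>(x, v, Q). L x v Q)"
  shows D_x_eq: "D_x L x v Q = fst (A (x, v, Q))"
    and D_v_eq: "D_v L x v Q = fst (snd (A (x, v, Q)))"
    and gradient_xv_eq: "gradient (\<lambda>(y, w). L y w Q) (x, v) = (D_x L x v Q, D_v L x v Q)"
    and D_x_differentiable: "(\<lambda>P. D_x L x v P) differentiable at Q"
    and D_v_differentiable: "(\<lambda>P. D_v L x v P) differentiable at Q"
    and gradient_xv_differentiable: "gradient (\<lambda>(y, w). L y w Q) differentiable at (x, v)"
proof -
  let ?f = "\<lambda>(x, v, Q). L x v Q"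
  have f: "(?f has_derivative (\<lambda>h. h \<bullet> A z)) (at z)" for z
    using C2_gradient(1)[OF assms(1), of z] by (simp add: gderiv_def A_def)
  have dA: "A differentiable at z" for z
    unfolding A_def by (rule C2_gradient(2)[OF assms(1)])
  show 1: "D_x L x v Q = fst (A (x, v, Q))" for x v Q
  proof -
    have "((\<lambda>y. (y, v, Q)) has_derivative (\<lambda>h. (h, 0, 0))) (at x)"
      by (auto intro!: derivative_eq_intros simp: zero_prod_def)
    from has_derivative_compose[OF this f]
    show ?thesis
      unfolding D_x_def by (intro gradient_eq) (simp add: gderiv_def inner_prod_def)
  qed
  show 2: "D_v L x v Q = fst (snd (A (x, v, Q)))" for x v Q
  proof -
    have "((\<lambda>y. (x, y, Q)) has_derivative (\<lambda>h. (0, h, 0))) (at v)"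
      by (auto intro!: derivative_eq_intros simp: zero_prod_def)
    from has_derivative_compose[OF this f]
    show ?thesis
      unfolding D_v_def by (intro gradient_eq) (simp add: gderiv_def inner_prod_def)
  qed
  show 3: "gradient (\<lambda>(y, w). L y w Q) (x, v) = (D_x L x v Q, D_v L x v Q)" for x v Q
  proof -
    have "((\<lambda>z. (fst z, snd z, Q)) has_derivative (\<lambda>h. (fst h, snd h, 0))) (at (x, v))"
      by (auto intro!: derivative_eq_intros)
    from has_derivative_compose[OF this f]
    show ?thesis
      unfolding 1 2 by (intro gradient_eq) (simp add: gderiv_def inner_prod_def split_def)
  qed
  have 4: "(\<lambda>P. A (x, v, P)) differentiable at Q"
  proof (rule differentiable_compose[OF dA])
    show "(\<lambda>P. (x, v, P)) differentiable at Q"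
      by (rule differentiableI[where f' = "\<lambda>h. (0, 0, h)"]) (auto intro!: derivative_eq_intros simp: zero_prod_def)
  qed
  then obtain A' where A': "((\<lambda>P. A (x, v, P)) has_derivative A') (at Q)"
    unfolding differentiable_def by blast
  from has_derivative_fst[OF A'] show "(\<lambda>P. D_x L x v P) differentiable at Q"
    unfolding 1 by (rule differentiableI)
  from has_derivative_fst[OF has_derivative_snd[OF A']] show "(\<lambda>P. D_v L x v P) differentiable at Q"
    unfolding 2 by (rule differentiableI)
  have "(\<lambda>z. A (fst z, snd z, Q)) differentiable at (x, v)"
  proof (rule differentiable_compose[OF dA])
    show "(\<lambda>z. (fst z, snd z, Q)) differentiable at (x, v)"
      by (rule differentiableI[where f' = "\<lambda>h. (fst h, snd h, 0)"]) (auto intro!: derivative_eq_intros)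
  qed
  then obtain A' where "((\<lambda>z. A (fst z, snd z, Q)) has_derivative A') (at (x, v))"
    unfolding differentiable_def by blast
  then have "((\<lambda>z. (fst (A (fst z, snd z, Q)), fst (snd (A (fst z, snd z, Q))))) has_derivative
     (\<lambda>h. (fst (A' h), fst (snd (A' h))))) (at (x, v))"
    by (intro has_derivative_Pair has_derivative_fst has_derivative_snd)
  moreover have "gradient (\<lambda>(y, w). L y w Q) = (\<lambda>z. (fst (A (fst z, snd z, Q)), fst (snd (A (fst z, snd z, Q)))))"
    using 1 2 3 by (auto simp: fun_eq_iff)
  ultimately show "gradient (\<lambda>(y, w). L y w Q) differentiable at (x, v)"
    by (simp add: differentiableI)
qed

lemma onorm_le_Linf_norm: "ereal (onorm (A x v Q)) \<le> Linf_norm A"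
  using SUP_upper[of "(x, v, Q)" UNIV "\<lambda>(x, v, Q). ereal (onorm (A x v Q))"]
  by (simp add: Linf_norm_def)

lemma bounded_derivative_diff_le:
  fixes f :: "'a::real_normed_vector \<Rightarrow> 'b::real_normed_vector"
  assumes "\<And>P. f differentiable at P" "\<And>P. onorm (frechet_derivative f (at P)) \<le> M"
  shows "norm (f P1 - f P0) \<le> M * norm (P1 - P0)"
proof (rule differentiable_bound[OF convex_UNIV])
  show "(f has_derivative frechet_derivative f (at P)) (at P within UNIV)" for P
    using assms(1)[of P] by (simp add: frechet_derivative_works)
qed (use assms(2) in simp_all)

text \<open>Replaces the hypotheses on second derivatives by first-order ones: Lipschitz bounds in
  \<open>Q\<close> by the mean value inequality, and strong monotonicity of the gradient in
  \<open>(x, v)\<close>.\<close>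

lemma lagrangian_bounds:
  fixes L :: "'d::finite lagrangian"
  assumes L: "C2 (\<lambda>(x, v, Q). L x v Q)" and "c > 0"
    and hess: "\<And>x v Q h. h \<bullet> D2_xv L x v Q h \<ge> c * (h \<bullet> h)"
    and M: "ereal (c\<^sup>2) > 2 * (max (Linf_norm (D2_vQ L)) (Linf_norm (D2_xQ L)))\<^sup>2"
  obtains M where "M \<ge> 0" "2 * M\<^sup>2 < c\<^sup>2"
    "\<And>x v P0 P1. norm (D_x L x v P1 - D_x L x v P0) \<le> M * norm (P1 - P0)"
    "\<And>x v P0 P1. norm (D_v L x v P1 - D_v L x v P0) \<le> M * norm (P1 - P0)"
    "\<And>x0 v0 x1 v1 P. (D_x L x1 v1 P - D_x L x0 v0 P) \<bullet> (x1 - x0)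
       + (D_v L x1 v1 P - D_v L x0 v0 P) \<bullet> (v1 - v0)
       \<ge> c * ((norm (x1 - x0))\<^sup>2 + (norm (v1 - v0))\<^sup>2)"
proof -
  define N where "N = max (Linf_norm (D2_vQ L)) (Linf_norm (D2_xQ L))"
  have ge: "ereal (onorm (D2_vQ L x v Q)) \<le> N" "ereal (onorm (D2_xQ L x v Q)) \<le> N" for x v Q
    unfolding N_def by (rule max.coboundedI1 max.coboundedI2, rule onorm_le_Linf_norm)+
  \<comment> \<open>The suprema are taken in \<open>ereal\<close>, so a lower bound is needed to
    exclude the value \<open>-\<infinity>\<close>.\<close>
  have "0 \<le> onorm (D2_vQ L 0 0 0)"
    unfolding D2_vQ_def
    by (intro onorm_pos_le has_derivative_bounded_linear[OF iffD1[OF frechet_derivative_works D_v_differentiable[OF L]]])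
  then have N0: "0 \<le> N"
    using order_trans[OF _ ge(1)[of 0 0 0], of 0] by (simp add: zero_ereal_def)
  \<comment> \<open>Boundedness of the mixed derivatives is forced by the smallness condition: an
    infinite \<open>N\<close> could not satisfy a strict bound by a real number.\<close>
  have "N \<noteq> \<infinity>"
    using M unfolding N_def[symmetric] by auto
  with N0 obtain M where M': "N = ereal M" "M \<ge> 0"
    by (cases N) auto
  show thesis
  proof
    show "M \<ge> 0" by fact
    show "2 * M\<^sup>2 < c\<^sup>2"
      using M unfolding N_def[symmetric] M' by (simp add: power2_eq_square)
    show "norm (D_x L x v P1 - D_x L x v P0) \<le> M * norm (P1 - P0)" for x v P0 P1
      using ge(2)[of x v] by (intro bounded_derivative_diff_le D_x_differentiable[OF L]) (simp add: M' D2_xQ_def)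
    show "norm (D_v L x v P1 - D_v L x v P0) \<le> M * norm (P1 - P0)" for x v P0 P1
      using ge(1)[of x v] by (intro bounded_derivative_diff_le D_v_differentiable[OF L]) (simp add: M' D2_vQ_def)
    show "(D_x L x1 v1 P - D_x L x0 v0 P) \<bullet> (x1 - x0)
       + (D_v L x1 v1 P - D_v L x0 v0 P) \<bullet> (v1 - v0)
       \<ge> c * ((norm (x1 - x0))\<^sup>2 + (norm (v1 - v0))\<^sup>2)" for x0 v0 x1 v1 P
    proof -
      have "c * (norm ((x1, v1) - (x0, v0)))\<^sup>2 \<le> (gradient (\<lambda>(y, w). L y w P) (x1, v1)
          - gradient (\<lambda>(y, w). L y w P) (x0, v0)) \<bullet> ((x1, v1) - (x0, v0))"
      proof (rule inner_gradient_diff_ge)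
        show "gradient (\<lambda>(y, w). L y w P) differentiable at z" for z
          using gradient_xv_differentiable[OF L, of P "fst z" "snd z"] by simp
        show "c * (h \<bullet> h) \<le> h \<bullet> hessian (\<lambda>(y, w). L y w P) z h" for z h
          using hess[of h "fst z" "snd z" P] by (simp add: D2_xv_def)
      qed
      then show ?thesis
        unfolding gradient_xv_eq[OF L] by (simp add: inner_prod_def norm_Pair)
    qed
  qed
qed

section \<open>Energy estimate for the Euler--Lagrange system\<close>

text \<open>Hamiltonian form with an explicit momentum \<open>p\<close> and one common exceptional
  null set. The initial position is left free, so that trajectories with different starting points
  can be compared.\<close>

definition EL_trajectory ::
    "real \<Rightarrow> 'd::finite lagrangian \<Rightarrow> (real^'d \<Rightarrow> real) \<Rightarrow> (real \<Rightarrow> real^'d) \<Rightarrow>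
     (real \<Rightarrow> real^'d) \<Rightarrow> (real \<Rightarrow> real^'d) \<Rightarrow> bool" where
  "EL_trajectory T L g Q x p \<longleftrightarrow>
     abs_cont_on 0 T x \<and> abs_cont_on 0 T p \<and> p T = - gradient g (x T) \<and>
     (AE t in lebesgue_on {0..T}.
        (x has_vector_derivative velocity T x t) (at t within {0..T}) \<and>
        (p has_vector_derivative D_x L (x t) (velocity T x t) (Q t)) (at t within {0..T}) \<and>
        p t = D_v L (x t) (velocity T x t) (Q t))"

lemma EL_solution_trajectoryE:
  assumes "EL_solution T L g a Q x"
  obtains p where "EL_trajectory T L g Q x p"
proof -
  obtain p where p: "abs_cont_on 0 T p" "p T = - gradient g (x T)"
    "AE t in lebesgue_on {0..T}. p t = D_v L (x t) (velocity T x t) (Q t)"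
    "AE t in lebesgue_on {0..T}.
       (p has_vector_derivative D_x L (x t) (velocity T x t) (Q t)) (at t within {0..T})"
    and x: "abs_cont_on 0 T x" "AE t in lebesgue_on {0..T}. x differentiable (at t within {0..T})"
    using assms unfolding EL_solution_def by blast
  have "AE t in lebesgue_on {0..T}.
        (x has_vector_derivative velocity T x t) (at t within {0..T}) \<and>
        (p has_vector_derivative D_x L (x t) (velocity T x t) (Q t)) (at t within {0..T}) \<and>
        p t = D_v L (x t) (velocity T x t) (Q t)"
    using p(3,4) x(2)
  proof eventually_elim
    case (elim t)
    then show ?case
      unfolding velocity_def by (simp add: vector_derivative_works[symmetric])
  qed
  with p x show thesis
    by (intro that[of p]) (simp add: EL_trajectory_def)
qed

lemma EL_trajectory_velocity_has_integral:
  assumes "EL_trajectory T L g Q x p" "0 \<le> T"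
  shows "(velocity T x has_integral (x T - x 0)) {0..T}"
  using assms unfolding EL_trajectory_def
  by (intro abs_cont_on_has_integral_AE) (auto elim: eventually_mono)

text \<open>Measurability of the velocity is no part of the notion of solution; it comes with the
  gauge integrability of the derivative of an absolutely continuous curve.\<close>

lemma EL_trajectory_velocity_measurable:
  assumes "EL_trajectory T L g Q x p" "0 \<le> T"
  shows "velocity T x \<in> borel_measurable (lebesgue_on {0..T})"
  using EL_trajectory_velocity_has_integral[OF assms] integrable_imp_measurable by blast

lemma L2_diff:
  assumes "f \<in> L2 T" "g \<in> L2 T"
  shows "(\<lambda>t. f t - g t) \<in> L2 T"
proof -
  have m: "f \<in> borel_measurable (lebesgue_on {0..T})" "g \<in> borel_measurable (lebesgue_on {0..T})"
    and i: "integrable (lebesgue_on {0..T}) (\<lambda>t. 2 * (norm (f t))\<^sup>2 + 2 * (norm (g t))\<^sup>2)"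
    using assms by (auto simp: L2_def)
  have "integrable (lebesgue_on {0..T}) (\<lambda>t. (norm (f t - g t))\<^sup>2)"
  proof (rule Bochner_Integration.integrable_bound[OF i])
    have "(norm (f t - g t))\<^sup>2 \<le> 2 * (norm (f t))\<^sup>2 + 2 * (norm (g t))\<^sup>2" for t
      using norm_triangle_ineq4[of "f t" "g t"] sum_squares_bound[of "norm (f t)" "norm (g t)"]
        power_mono[of "norm (f t - g t)" "norm (f t) + norm (g t)" 2]
      by (simp add: power2_sum)
    then show "AE t in lebesgue_on {0..T}. norm ((norm (f t - g t))\<^sup>2)
        \<le> norm (2 * (norm (f t))\<^sup>2 + 2 * (norm (g t))\<^sup>2)"
      by (intro AE_I2) (auto intro: order_trans)
  qed (use m in measurable)
  then show ?thesis
    using m by (auto simp: L2_def)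
qed

text \<open>Collects the first-order consequences of the hypotheses. The smallness condition
  \<open>2 * M\<^sup>2 < c\<^sup>2\<close> stays outside and enters in the final theorem as
  \<open>defect < 1\<close>.\<close>

locale convex_lagrangian =
  fixes T c M :: real and L :: "'d::finite lagrangian" and g :: "real^'d \<Rightarrow> real"
  assumes T_pos: "0 < T" and c_pos: "0 < c" and M_nonneg: "0 \<le> M"
    and D_x_lipschitz: "norm (D_x L x v P1 - D_x L x v P0) \<le> M * norm (P1 - P0)"
    and D_v_lipschitz: "norm (D_v L x v P1 - D_v L x v P0) \<le> M * norm (P1 - P0)"
    and D_xv_monotone: "c * ((norm (x1 - x0))\<^sup>2 + (norm (v1 - v0))\<^sup>2)
       \<le> (D_x L x1 v1 P - D_x L x0 v0 P) \<bullet> (x1 - x0) + (D_v L x1 v1 P - D_v L x0 v0 P) \<bullet> (v1 - v0)"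
    and g_monotone: "0 \<le> (gradient g x1 - gradient g x0) \<bullet> (x1 - x0)"
begin

lemma young_inner:
  fixes u w :: "'a::real_inner"
  assumes "norm u \<le> M * r"
  shows "- (u \<bullet> w) \<le> M\<^sup>2 / (2 * c) * r\<^sup>2 + c / 2 * (norm w)\<^sup>2"
proof -
  have "- (u \<bullet> w) \<le> norm u * norm w"
    using Cauchy_Schwarz_ineq2[of u w] by linarith
  also have "\<dots> \<le> M * r * norm w"
    by (intro mult_right_mono assms) simp
  also have "\<dots> \<le> M\<^sup>2 / (2 * c) * r\<^sup>2 + c / 2 * (norm w)\<^sup>2"
  proof -
    \<comment> \<open>Expanding this square and dividing by \<open>2 * c\<close> is Young's
      inequality with weight \<open>c\<close>.\<close>
    have "0 \<le> (M * r - c * norm w)\<^sup>2" by simp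
    then have "2 * c * (M * r * norm w) \<le> M\<^sup>2 * r\<^sup>2 + c\<^sup>2 * (norm w)\<^sup>2"
      by (simp add: power2_diff power_mult_distrib algebra_simps)
    then show ?thesis
      using c_pos by (simp add: field_simps power2_eq_square)
  qed
  finally show ?thesis .
qed

text \<open>Young's inequality with weight \<open>c\<close> in each of the two components gives the factor
  \<open>M\<^sup>2 / c\<close>, which is what makes \<open>2 * M\<^sup>2 < c\<^sup>2\<close> the right smallness condition.\<close>

lemma perturbed_monotone:
  "c / 2 * ((norm (x1 - x0))\<^sup>2 + (norm (v1 - v0))\<^sup>2) \<le>
    (D_x L x1 v1 P1 - D_x L x0 v0 P0) \<bullet> (x1 - x0) + (D_v L x1 v1 P1 - D_v L x0 v0 P0) \<bullet> (v1 - v0)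
    + M\<^sup>2 / c * (norm (P1 - P0))\<^sup>2"
proof -
  have "M\<^sup>2 / c * (norm (P1 - P0))\<^sup>2 = M\<^sup>2 / (2 * c) * (norm (P1 - P0))\<^sup>2 + M\<^sup>2 / (2 * c) * (norm (P1 - P0))\<^sup>2"
    using c_pos by (simp add: field_simps)
  \<comment> \<open>Each difference splits into a change of \<open>(x, v)\<close> at fixed
    \<open>P1\<close>, handled by monotonicity, and a change from \<open>P0\<close> to
    \<open>P1\<close> at the fixed point \<open>(x0, v0)\<close>, handled by the Lipschitz bounds
    and Young's inequality.\<close>
  then show ?thesis
    using D_xv_monotone[of x1 x0 v1 v0 P1]
      young_inner[OF D_x_lipschitz[of x0 v0 P1 P0], of "x1 - x0"]
      young_inner[OF D_v_lipschitz[of x0 v0 P1 P0], of "v1 - v0"]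
    by (simp add: algebra_simps inner_diff_left)
qed

text \<open>Integrates the derivative \<open>q \<bullet> v + q' \<bullet> y\<close> of
  \<open>q \<bullet> y\<close>, in which \<open>q\<close> and \<open>q'\<close> are a.e. the
  differences of \<open>D_v L\<close> and \<open>D_x L\<close>. The boundary term at 0 is kept so
  that one estimate serves two purposes: it vanishes for equal initial points, and for equal
  \<open>Q\<close> it is the only term left.\<close>

lemma EL_energy_estimate:
  assumes t0: "EL_trajectory T L g Q0 x0 p0" and t1: "EL_trajectory T L g Q1 x1 p1"
    and Q: "Q0 \<in> L2 T" "Q1 \<in> L2 T"
  defines "E \<equiv> \<lambda>t. (norm (x1 t - x0 t))\<^sup>2 + (norm (velocity T x1 t - velocity T x0 t))\<^sup>2"
  shows "integrable (lebesgue_on {0..T}) E"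
    and "c / 2 * (LINT t | lebesgue_on {0..T}. E t)
      \<le> M\<^sup>2 / c * (L2_norm T (\<lambda>t. Q1 t - Q0 t))\<^sup>2 - (p1 0 - p0 0) \<bullet> (x1 0 - x0 0)"
proof -
  define y where "y t = x1 t - x0 t" for t
  define v where "v t = velocity T x1 t - velocity T x0 t" for t
  define q where "q t = p1 t - p0 t" for t
  define q' where "q' t = D_x L (x1 t) (velocity T x1 t) (Q1 t) - D_x L (x0 t) (velocity T x0 t) (Q0 t)" for t
  note acs = t0[unfolded EL_trajectory_def, THEN conjunct1] t1[unfolded EL_trajectory_def, THEN conjunct1]
    t0[unfolded EL_trajectory_def, THEN conjunct2, THEN conjunct1]
    t1[unfolded EL_trajectory_def, THEN conjunct2, THEN conjunct1]
  have ac: "abs_cont_on 0 T y" "abs_cont_on 0 T q"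
    unfolding y_def q_def by (intro abs_cont_on_diff acs)+
  have qT: "q T = - (gradient g (x1 T) - gradient g (x0 T))"
    using t0 t1 by (simp add: EL_trajectory_def q_def)
  have ae: "AE t in lebesgue_on {0..T}.
      ((\<lambda>t. q t \<bullet> y t) has_vector_derivative (q t \<bullet> v t + q' t \<bullet> y t)) (at t within {0..T}) \<and>
      q t = D_v L (x1 t) (velocity T x1 t) (Q1 t) - D_v L (x0 t) (velocity T x0 t) (Q0 t)"
    using t0[unfolded EL_trajectory_def, THEN conjunct2, THEN conjunct2, THEN conjunct2]
      t1[unfolded EL_trajectory_def, THEN conjunct2, THEN conjunct2, THEN conjunct2]
  proof eventually_elim
    case (elim t)
    then have "(y has_vector_derivative v t) (at t within {0..T})" "(q has_vector_derivative q' t) (at t within {0..T})"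
      unfolding y_def v_def q_def q'_def by (auto intro: has_vector_derivative_diff)
    then have "((\<lambda>t. q t \<bullet> y t) has_vector_derivative (q t \<bullet> v t + q' t \<bullet> y t)) (at t within {0..T})"
      by (intro bounded_bilinear.has_vector_derivative[OF bounded_bilinear_inner])
    then show ?case
      using elim by (simp add: q_def)
  qed
  have "((\<lambda>t. q t \<bullet> v t + q' t \<bullet> y t) has_integral (q T \<bullet> y T - q 0 \<bullet> y 0)) {0..T}"
    using ae T_pos ac by (intro abs_cont_on_has_integral_AE abs_cont_on_inner) (auto elim: eventually_mono)
  moreover have "((\<lambda>t. (norm (Q1 t - Q0 t))\<^sup>2) has_integral (L2_norm T (\<lambda>t. Q1 t - Q0 t))\<^sup>2) {0..T}"
  proof -
    have "integrable (lebesgue_on {0..T}) (\<lambda>t. (norm (Q1 t - Q0 t))\<^sup>2)"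
      using L2_diff[OF Q(2,1)] by (simp add: L2_def)
    from has_integral_integral_lebesgue_on[OF this]
    show ?thesis
      by (simp add: L2_norm_def L2_inner_def power2_norm_eq_inner)
  qed
  ultimately have int: "((\<lambda>t. q t \<bullet> v t + q' t \<bullet> y t + M\<^sup>2 / c * (norm (Q1 t - Q0 t))\<^sup>2) has_integral
      (q T \<bullet> y T - q 0 \<bullet> y 0) + M\<^sup>2 / c * (L2_norm T (\<lambda>t. Q1 t - Q0 t))\<^sup>2) {0..T}"
    by (intro has_integral_add has_integral_mult_right)
  have "continuous_on {0..T} y"
    using ac(1) by (rule abs_cont_on_imp_continuous_on)
  then have "y \<in> borel_measurable (lebesgue_on {0..T})"
    by (rule continuous_imp_measurable_on_sets_lebesgue) simp
  moreover have "v \<in> borel_measurable (lebesgue_on {0..T})"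
    unfolding v_def using EL_trajectory_velocity_measurable[OF t0] EL_trajectory_velocity_measurable[OF t1] T_pos
    by (intro borel_measurable_diff) auto
  ultimately have m: "(\<lambda>t. c / 2 * E t) \<in> borel_measurable (lebesgue_on {0..T})"
    unfolding E_def y_def[symmetric] v_def[symmetric] by measurable
  have le: "AE t in lebesgue_on {0..T}.
      c / 2 * E t \<le> q t \<bullet> v t + q' t \<bullet> y t + M\<^sup>2 / c * (norm (Q1 t - Q0 t))\<^sup>2"
    using ae
  proof eventually_elim
    case (elim t)
    then have "q t = D_v L (x1 t) (velocity T x1 t) (Q1 t) - D_v L (x0 t) (velocity T x0 t) (Q0 t)"
      by simp
    then show ?case
      using perturbed_monotone[of "x1 t" "x0 t" "velocity T x1 t" "velocity T x0 t" "Q1 t" "Q0 t"]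
      unfolding E_def q'_def y_def v_def by simp
  qed
  have nn: "0 \<le> c / 2 * E t" for t
    using c_pos by (simp add: E_def)
  note est = integrable_AE_le_has_integral[OF _ m nn le int]
  have "integrable (lebesgue_on {0..T}) (\<lambda>t. 2 / c * (c / 2 * E t))"
    by (intro integrable_mult_right est(1)) simp
  then show "integrable (lebesgue_on {0..T}) E"
    using c_pos by simp
  have "c / 2 * (LINT t | lebesgue_on {0..T}. E t) = (LINT t | lebesgue_on {0..T}. c / 2 * E t)"
    by simp
  also have "\<dots> \<le> (q T \<bullet> y T - q 0 \<bullet> y 0) + M\<^sup>2 / c * (L2_norm T (\<lambda>t. Q1 t - Q0 t))\<^sup>2"
    by (rule est(2)) simp
  also have "q T \<bullet> y T \<le> 0"
    using g_monotone[of "x1 T" "x0 T"] by (simp add: qT y_def inner_diff_left)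
  finally show "c / 2 * (LINT t | lebesgue_on {0..T}. E t)
      \<le> M\<^sup>2 / c * (L2_norm T (\<lambda>t. Q1 t - Q0 t))\<^sup>2 - (p1 0 - p0 0) \<bullet> (x1 0 - x0 0)"
    by (simp add: q_def y_def)
qed

end

text \<open>Converts the integrated energy into a bound at each time: the derivative of
  \<open>y \<bullet> y\<close> is \<open>2 * (y \<bullet> v)\<close>, which is at most
  \<open>E\<close> because the square of \<open>norm (y - v)\<close> is nonnegative.\<close>

lemma EL_trajectory_dist_le:
  assumes t0: "EL_trajectory T L g0 Q0 x0 p0" and t1: "EL_trajectory T L g1 Q1 x1 p1"
  defines "E \<equiv> \<lambda>t. (norm (x1 t - x0 t))\<^sup>2 + (norm (velocity T x1 t - velocity T x0 t))\<^sup>2"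
  assumes E: "integrable (lebesgue_on {0..T}) E" and t: "t \<in> {0..T}"
  shows "(norm (x1 t - x0 t))\<^sup>2 \<le> (norm (x1 0 - x0 0))\<^sup>2 + (LINT t | lebesgue_on {0..T}. E t)"
proof -
  define y where "y t = x1 t - x0 t" for t
  define v where "v t = velocity T x1 t - velocity T x0 t" for t
  have "abs_cont_on 0 T y"
    using t0 t1 unfolding y_def EL_trajectory_def by (intro abs_cont_on_diff) auto
  then have "abs_cont_on 0 t y"
    by (rule abs_cont_on_subset) (use t in auto)
  then have ac: "abs_cont_on 0 t (\<lambda>s. y s \<bullet> y s)"
    by (intro abs_cont_on_inner)
  have ae: "AE s in lebesgue_on {0..T}.
      ((\<lambda>s. y s \<bullet> y s) has_vector_derivative (2 * (y s \<bullet> v s))) (at s within {0..T})"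
    using t0[unfolded EL_trajectory_def, THEN conjunct2, THEN conjunct2, THEN conjunct2]
      t1[unfolded EL_trajectory_def, THEN conjunct2, THEN conjunct2, THEN conjunct2]
  proof eventually_elim
    case (elim s)
    then have "(y has_vector_derivative v s) (at s within {0..T})"
      unfolding y_def v_def by (auto intro: has_vector_derivative_diff)
    from bounded_bilinear.has_vector_derivative[OF bounded_bilinear_inner this this]
    show ?case by (simp add: inner_commute)
  qed
  obtain N where N: "negligible N" "\<And>s. s \<in> {0..T} - N \<Longrightarrow>
      ((\<lambda>s. y s \<bullet> y s) has_vector_derivative (2 * (y s \<bullet> v s))) (at s within {0..T})"
    by (rule AE_lebesgue_on_negligibleE[OF ae]) simp_all
  have "((\<lambda>s. 2 * (y s \<bullet> v s)) has_integral (y t \<bullet> y t - y 0 \<bullet> y 0)) {0..t}"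
  proof (rule abs_cont_on_has_integral[OF _ ac N(1)])
    show "((\<lambda>s. y s \<bullet> y s) has_vector_derivative (2 * (y s \<bullet> v s))) (at s within {0..t})"
      if "s \<in> {0..t} - N" for s
      using that t by (intro has_vector_derivative_within_subset[OF N(2)[of s]]) auto
  qed (use t in auto)
  moreover have EI: "(E has_integral (LINT t | lebesgue_on {0..T}. E t)) {0..T}"
    using E by (intro has_integral_integral_lebesgue_on) auto
  from has_integral_integrable[OF this] have Et: "E integrable_on {0..t}"
    by (rule integrable_on_subinterval) (use t in auto)
  ultimately have "y t \<bullet> y t - y 0 \<bullet> y 0 \<le> integral {0..t} E"
  proof (rule has_integral_le[OF _ integrable_integral])
    show "2 * (y s \<bullet> v s) \<le> E s" for s
    proof -
      have "0 \<le> (norm (y s - v s))\<^sup>2" by simp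
      also have "\<dots> = E s - 2 * (y s \<bullet> v s)"
        unfolding E_def y_def[symmetric] v_def[symmetric] power2_norm_eq_inner
        by (simp add: inner_diff inner_commute)
      finally show ?thesis by simp
    qed
  qed
  also have "\<dots> \<le> integral {0..T} E"
    using t has_integral_integrable[OF EI] Et by (intro integral_subset_le) (auto simp: E_def)
  also have "\<dots> = (LINT t | lebesgue_on {0..T}. E t)"
    using EI by (rule integral_unique)
  finally show ?thesis
    by (simp add: y_def power2_norm_eq_inner)
qed

text \<open>Testing monotonicity against the points \<open>z \<plusminus> i\<close>, \<open>i \<in> Basis\<close>, bounds each coordinate of \<open>P b\<close>
  by \<open>K + r * norm (P b)\<close>; the last term is absorbed for small \<open>r\<close>.\<close>

lemma monotone_map_locally_bounded:
  fixes P :: "'a::euclidean_space \<Rightarrow> 'a"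
  assumes mono: "\<And>a b. 0 \<le> (P a - P b) \<bullet> (a - b)"
  obtains r B where "r > 0" "\<And>b. dist z b < r \<Longrightarrow> norm (P b) \<le> B"
proof -
  define n where "n = real DIM('a)"
  have n: "n \<ge> 1" unfolding n_def by (simp add: Suc_leI)
  \<comment> \<open>Summing over the basis gives one bound valid for all test points
    \<open>z + i\<close> and \<open>z - i\<close>. The factor 2 will come from
    \<open>norm (u - d) \<le> 2\<close>.\<close>
  define K where "K = (\<Sum>i\<in>(Basis::'a set). 2 * (norm (P (z + i)) + norm (P (z - i))))"
  have Kge: "2 * norm (P (z + i)) \<le> K" "2 * norm (P (z - i)) \<le> K" if "i \<in> Basis" for i
  proof -
    have "2 * (norm (P (z + i)) + norm (P (z - i))) \<le> K"
      unfolding K_def using that by (intro member_le_sum) auto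
    then show "2 * norm (P (z + i)) \<le> K" "2 * norm (P (z - i)) \<le> K"
      using norm_ge_zero[of "P (z + i)"] norm_ge_zero[of "P (z - i)"]
      by (simp_all only: distrib_left)
  qed
  \<comment> \<open>Chosen so that \<open>n * r = 1 / 2\<close>: after summation over the
    coordinates half of \<open>norm (P b)\<close> is absorbed into the left-hand side, leaving the
    bound \<open>2 * (n * K)\<close>.\<close>
  define r where "r = 1 / (2 * n)"
  have r: "r > 0" "r \<le> 1" "n * r = 1 / 2" using n by (auto simp: r_def field_simps)
  have "norm (P b) \<le> 2 * (n * K)" if b: "dist z b < r" for b
  proof -
    define d where "d = b - z"
    have d: "norm d \<le> r" "norm d \<le> 1"
      using b r(2) by (auto simp: d_def dist_norm norm_minus_commute)
    have *: "P b \<bullet> u \<le> K + norm (P b) * r" if u: "norm u = 1" "2 * norm (P (z + u)) \<le> K" for u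
    proof -
      have "P b \<bullet> (u - d) \<le> P (z + u) \<bullet> (u - d)"
        using mono[of "z + u" b] by (simp add: d_def algebra_simps)
      also have "\<dots> \<le> norm (P (z + u)) * norm (u - d)"
        by (rule norm_cauchy_schwarz)
      also have "\<dots> \<le> norm (P (z + u)) * 2"
        using norm_triangle_ineq4[of u d] u d by (intro mult_left_mono) auto
      also have "\<dots> \<le> K"
        using u by simp
      finally have "P b \<bullet> u \<le> K + P b \<bullet> d"
        by (simp add: inner_diff_right)
      also have "P b \<bullet> d \<le> norm (P b) * norm d"
        by (rule norm_cauchy_schwarz)
      also have "\<dots> \<le> norm (P b) * r"
        using d by (intro mult_left_mono) auto
      finally show ?thesis by simp
    qed
    have "norm (P b) \<le> (\<Sum>i\<in>Basis. \<bar>P b \<bullet> i\<bar>)"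
      by (rule norm_le_l1)
    also have "\<dots> \<le> (\<Sum>i\<in>(Basis::'a set). K + norm (P b) * r)"
    proof (rule sum_mono)
      fix i :: 'a assume i: "i \<in> Basis"
      show "\<bar>P b \<bullet> i\<bar> \<le> K + norm (P b) * r"
        using *[of i] *[of "- i"] Kge[OF i] i by (simp add: abs_le_iff)
    qed
    also have "\<dots> = n * K + norm (P b) * (n * r)"
      by (simp add: n_def algebra_simps)
    finally show ?thesis
      unfolding r(3) by simp
  qed
  with r(1) show thesis by (rule that)
qed

section \<open>Uniqueness of the curves and their continuity in the initial point\<close>

context convex_lagrangian
begin

text \<open>For equal \<open>Q\<close> and equal initial points both terms on the right of the
  energy estimate vanish. Hence the curves agree on \<open>{0..T}\<close>, and extensionality
  settles the values outside.\<close>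

lemma EL_solution_unique:
  assumes Q: "Q \<in> L2 T" and x0: "EL_solution T L g a Q x0" and x1: "EL_solution T L g a Q x1"
  shows "x0 = x1"
proof -
  obtain p0 where t0: "EL_trajectory T L g Q x0 p0" using EL_solution_trajectoryE[OF x0] .
  obtain p1 where t1: "EL_trajectory T L g Q x1 p1" using EL_solution_trajectoryE[OF x1] .
  have init: "x0 0 = a" "x1 0 = a" and ext: "x0 \<in> extensional {0..T}" "x1 \<in> extensional {0..T}"
    using x0 x1 by (auto simp: EL_solution_def)
  note est = EL_energy_estimate[OF t0 t1 Q Q]
  have zero: "(LINT t | lebesgue_on {0..T}. (norm (x1 t - x0 t))\<^sup>2 + (norm (velocity T x1 t - velocity T x0 t))\<^sup>2) \<le> 0"
    using est(2) c_pos by (simp add: init L2_norm_def L2_inner_def mult_le_0_iff)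
  show ?thesis
  proof (rule extensionalityI[OF ext])
    fix t assume "t \<in> {0..T}"
    note EL_trajectory_dist_le[OF t0 t1 est(1) this]
    also have "(norm (x1 0 - x0 0))\<^sup>2 + (LINT t | lebesgue_on {0..T}. (norm (x1 t - x0 t))\<^sup>2
        + (norm (velocity T x1 t - velocity T x0 t))\<^sup>2) \<le> 0"
      using zero by (simp add: init)
    finally have "norm (x1 t - x0 t) = 0"
      by simp
    then show "x0 t = x1 t"
      by simp
  qed
qed

lemma EL_curve_solution:
  assumes "Q \<in> L2 T" "\<exists>x. EL_solution T L g a Q x"
  shows "EL_solution T L g a Q (EL_curve T L g a Q)"
  unfolding EL_curve_def
proof (rule theI'[of "EL_solution T L g a Q"])
  show "\<exists>!x. EL_solution T L g a Q x"
    using assms(2) EL_solution_unique[OF assms(1)] by blast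
qed

text \<open>\<open>D_x L\<close> need not be Lipschitz in \<open>(x, v)\<close>, so Gronwall is not available. Instead, the initial
  momentum \<open>a \<mapsto> - p a 0\<close> is a monotone map defined on the whole space, hence locally bounded,
  and the energy estimate turns local boundedness into continuity of \<open>a \<mapsto> X a\<close>.\<close>

lemma EL_solutions_continuous:
  assumes Q: "Q \<in> L2 T" and sol: "\<And>a. EL_solution T L g a Q (X a)"
  shows "continuous_on ({0..T} \<times> UNIV) (\<lambda>(t, a). X a t)"
proof -
  have "\<exists>p. EL_trajectory T L g Q (X a) p" for a
    using EL_solution_trajectoryE[OF sol[of a]] by blast
  then obtain p where p: "\<And>a. EL_trajectory T L g Q (X a) (p a)" by metis
  have init: "X a 0 = a" for a
    using sol[of a] by (simp add: EL_solution_def)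
  \<comment> \<open>The sign turns the boundary term of the energy estimate into
    \<open>(P a - P b) \<bullet> (a - b)\<close>, whose nonnegativity is monotonicity of
    \<open>P\<close>.\<close>
  define P where "P a = - p a 0" for a
  define I where "I a b = (LINT t | lebesgue_on {0..T}. (norm (X a t - X b t))\<^sup>2
     + (norm (velocity T (X a) t - velocity T (X b) t))\<^sup>2)" for a b
  have I_le: "c / 2 * I a b \<le> (P a - P b) \<bullet> (a - b)" for a b
    using EL_energy_estimate(2)[OF p p Q Q, of a b]
    by (simp add: init I_def P_def L2_norm_def L2_inner_def inner_diff_left)
  have I_nonneg: "0 \<le> I a b" for a b
    unfolding I_def by (intro integral_nonneg_AE AE_I2) simp
  have dist_le: "(norm (X a t - X b t))\<^sup>2 \<le> (norm (a - b))\<^sup>2 + I a b" if "t \<in> {0..T}" for a b t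
    using EL_trajectory_dist_le[OF p p EL_energy_estimate(1)[OF p p Q Q] that] by (simp add: I_def init)
  have mono: "0 \<le> (P a - P b) \<bullet> (a - b)" for a b
    using c_pos by (intro order_trans[OF _ I_le[of a b]] mult_nonneg_nonneg I_nonneg) simp
  have "((\<lambda>(t, a). X a t) \<longlongrightarrow> X z t0) (at (t0, z) within {0..T} \<times> UNIV)" if t0: "t0 \<in> {0..T}" for t0 z
  proof -
    obtain r B where r: "r > 0" and B: "\<And>b. dist z b < r \<Longrightarrow> norm (P b) \<le> B"
      using monotone_map_locally_bounded[of P z] mono by blast
    let ?F = "at (t0, z) within {0..T} \<times> UNIV"
    \<comment> \<open>The square root bounds the distance of \<open>X a\<close> and
      \<open>X z\<close> at the same time, with \<open>2 * B\<close> bounding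
      \<open>norm (P a - P z)\<close> near \<open>z\<close>; the second summand is the modulus of
      continuity in time of the single curve \<open>X z\<close>.\<close>
    let ?h = "\<lambda>w. sqrt ((norm (snd w - z))\<^sup>2 + 2 / c * (2 * B * norm (snd w - z)))
        + norm (X z (fst w) - X z t0)"
    have fst: "(fst \<longlongrightarrow> t0) ?F" and snd: "(snd \<longlongrightarrow> z) ?F"
      using tendsto_fst[OF tendsto_ident_at[of "(t0, z)"]] tendsto_snd[OF tendsto_ident_at[of "(t0, z)"]] by auto
    have inS: "\<forall>\<^sub>F w in ?F. w \<in> {0..T} \<times> UNIV"
      by (simp add: eventually_at_filter)
    have "continuous_on {0..T} (X z)"
      using p[of z] abs_cont_on_imp_continuous_on by (auto simp: EL_trajectory_def)
    then have "((\<lambda>w. X z (fst w)) \<longlongrightarrow> X z t0) ?F"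
      using fst t0 by (rule continuous_on_tendsto_compose) (use inS in \<open>auto elim: eventually_mono\<close>)
    then have "(?h \<longlongrightarrow> sqrt ((norm (z - z))\<^sup>2 + 2 / c * (2 * B * norm (z - z))) + norm (X z t0 - X z t0)) ?F"
      by (intro tendsto_intros snd)
    then have h0: "(?h \<longlongrightarrow> 0) ?F" by simp
    have "\<forall>\<^sub>F w in ?F. dist z (snd w) < r"
      using tendstoD[OF snd r] by (simp add: dist_commute)
    with inS have "\<forall>\<^sub>F w in ?F. dist (case w of (t, a) \<Rightarrow> X a t) (X z t0) \<le> ?h w"
    proof eventually_elim
      case (elim w)
      obtain t a where w: "w = (t, a)" by (cases w)
      have ta: "t \<in> {0..T}" "dist z a < r" using elim by (auto simp: w)
      have "c / 2 * I a z \<le> (P a - P z) \<bullet> (a - z)" by (rule I_le)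
      also have "\<dots> \<le> norm (P a - P z) * norm (a - z)" by (rule norm_cauchy_schwarz)
      also have "\<dots> \<le> (2 * B) * norm (a - z)"
        using norm_triangle_ineq4[of "P a" "P z"] B[OF ta(2)] B[of z] r by (intro mult_right_mono) auto
      finally have "I a z \<le> 2 / c * (2 * B * norm (a - z))"
        using c_pos by (simp add: field_simps)
      then have "(norm (X a t - X z t))\<^sup>2 \<le> (norm (a - z))\<^sup>2 + 2 / c * (2 * B * norm (a - z))"
        using dist_le[OF ta(1), of a z] by simp
      then have "norm (X a t - X z t) \<le> sqrt ((norm (a - z))\<^sup>2 + 2 / c * (2 * B * norm (a - z)))"
        by (rule real_le_rsqrt)
      then show ?case
        using norm_triangle_ineq[of "X a t - X z t" "X z t - X z t0"] by (simp add: w dist_norm)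
    qed
    then have "((\<lambda>w. dist (case w of (t, a) \<Rightarrow> X a t) (X z t0)) \<longlongrightarrow> 0) ?F"
      by (intro Lim_null_comparison[OF _ h0]) simp
    then show ?thesis
      by (rule iffD2[OF tendsto_dist_iff])
  qed
  then show ?thesis
    by (auto simp: continuous_on_def)
qed

end

section \<open>Joint measurability of the velocity\<close>

lemma has_vector_derivative_within_alt:
  "(f has_vector_derivative d) (at t within S) \<longleftrightarrow>
    (\<forall>\<epsilon>>0. \<exists>\<delta>>0. \<forall>s\<in>S. \<bar>s - t\<bar> < \<delta> \<longrightarrow> norm (f s - f t - (s - t) *\<^sub>R d) \<le> \<epsilon> * \<bar>s - t\<bar>)"
  unfolding has_vector_derivative_def has_derivative_within_alt
  by (simp add: bounded_linear_scaleR_left)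

lemma has_vector_derivative_difference_quotient:
  assumes "(f has_vector_derivative d) (at t within S)"
    and \<sigma>: "\<sigma> \<longlonglongrightarrow> t" "\<And>n. \<sigma> n \<in> S" "\<And>n. \<sigma> n \<noteq> t"
  shows "(\<lambda>n. (f (\<sigma> n) - f t) /\<^sub>R (\<sigma> n - t)) \<longlonglongrightarrow> d"
proof (rule LIMSEQ_I)
  fix \<epsilon> :: real assume "\<epsilon> > 0"
  then have e2: "\<epsilon> / 2 > 0" by simp
  obtain \<delta> where \<delta>: "\<delta> > 0"
    "\<And>s. s \<in> S \<Longrightarrow> \<bar>s - t\<bar> < \<delta> \<Longrightarrow> norm (f s - f t - (s - t) *\<^sub>R d) \<le> \<epsilon> / 2 * \<bar>s - t\<bar>"
    using assms(1)[unfolded has_vector_derivative_within_alt, rule_format, OF e2] by blast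
  obtain n0 where n0: "\<And>n. n \<ge> n0 \<Longrightarrow> \<bar>\<sigma> n - t\<bar> < \<delta>"
    using LIMSEQ_D[OF \<sigma>(1) \<delta>(1)] by (auto simp: real_norm_def)
  show "\<exists>no. \<forall>n\<ge>no. norm ((f (\<sigma> n) - f t) /\<^sub>R (\<sigma> n - t) - d) < \<epsilon>"
  proof (intro exI allI impI)
    fix n assume n: "n \<ge> n0"
    define h where "h = \<sigma> n - t"
    have h: "h \<noteq> 0" using \<sigma>(3)[of n] by (simp add: h_def)
    have "(f (\<sigma> n) - f t) /\<^sub>R h - d = (f (\<sigma> n) - f t - h *\<^sub>R d) /\<^sub>R h"
      using h by (simp add: scaleR_diff_right)
    also have "norm \<dots> = norm (f (\<sigma> n) - f t - h *\<^sub>R d) / \<bar>h\<bar>"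
      by (simp add: divide_inverse mult.commute)
    also have "\<dots> \<le> \<epsilon> / 2"
      using \<delta>(2)[OF \<sigma>(2) n0[OF n]] h by (simp add: h_def[symmetric] divide_le_eq)
    also have "\<dots> < \<epsilon>" using \<open>\<epsilon> > 0\<close> by simp
    finally show "norm ((f (\<sigma> n) - f t) /\<^sub>R (\<sigma> n - t) - d) < \<epsilon>"
      by (simp add: h_def)
  qed
qed

lemma scaleR_inverse_diff:
  fixes u w :: "'a::real_vector"
  assumes "a \<noteq> 0" "b \<noteq> 0"
  shows "u /\<^sub>R a - w /\<^sub>R b = (b *\<^sub>R u - a *\<^sub>R w) /\<^sub>R (a * b)"
proof -
  have "inverse (a * b) * b = inverse a" "inverse (a * b) * a = inverse b"
    using assms by (simp_all add: field_simps)
  then show ?thesis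
    by (simp only: scaleR_diff_right scaleR_scaleR)
qed

text \<open>Cauchy criterion for difference quotients. Clearing denominators removes the need to
  exclude \<open>s1 = t\<close> or \<open>s2 = t\<close> and yields non-strict inequalities between
  continuous expressions; accuracy and radius range over countable sets. The sequence
  \<open>\<sigma>\<close> supplies, by completeness, the candidate for the derivative.\<close>

lemma differentiable_within_iff_Cauchy:
  fixes f :: "real \<Rightarrow> 'a::banach"
  assumes \<sigma>: "\<sigma> \<longlonglongrightarrow> t" "\<And>n. \<sigma> n \<in> S" "\<And>n. \<sigma> n \<noteq> t"
  shows "f differentiable (at t within S) \<longleftrightarrow>
    (\<forall>k. \<exists>n. \<forall>s1\<in>S. \<forall>s2\<in>S. \<bar>s1 - t\<bar> < inverse (Suc n) \<longrightarrow> \<bar>s2 - t\<bar> < inverse (Suc n) \<longrightarrow>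
      norm ((s2 - t) *\<^sub>R (f s1 - f t) - (s1 - t) *\<^sub>R (f s2 - f t)) \<le> inverse (Suc k) * \<bar>s1 - t\<bar> * \<bar>s2 - t\<bar>)"
    (is "_ \<longleftrightarrow> ?C")
proof
  assume "f differentiable (at t within S)"
  then obtain d where d: "(f has_vector_derivative d) (at t within S)"
    using vector_derivative_works by blast
  show ?C
  proof
    fix k :: nat
    have "inverse (real (Suc k)) / 2 > 0" by simp
    then obtain \<delta> where \<delta>: "\<delta> > 0" "\<And>s. s \<in> S \<Longrightarrow> \<bar>s - t\<bar> < \<delta> \<Longrightarrow>
        norm (f s - f t - (s - t) *\<^sub>R d) \<le> inverse (Suc k) / 2 * \<bar>s - t\<bar>"
      using d[unfolded has_vector_derivative_within_alt] by blast
    obtain n where n: "inverse (real (Suc n)) < \<delta>"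
      using reals_Archimedean[OF \<delta>(1)] by blast
    show "\<exists>n. \<forall>s1\<in>S. \<forall>s2\<in>S. \<bar>s1 - t\<bar> < inverse (Suc n) \<longrightarrow> \<bar>s2 - t\<bar> < inverse (Suc n) \<longrightarrow>
      norm ((s2 - t) *\<^sub>R (f s1 - f t) - (s1 - t) *\<^sub>R (f s2 - f t)) \<le> inverse (Suc k) * \<bar>s1 - t\<bar> * \<bar>s2 - t\<bar>"
    proof (intro exI ballI impI)
      fix s1 s2 assume s: "s1 \<in> S" "s2 \<in> S" "\<bar>s1 - t\<bar> < inverse (Suc n)" "\<bar>s2 - t\<bar> < inverse (Suc n)"
      \<comment> \<open>The two inserted multiples of \<open>d\<close> cancel.\<close>
      have "(s2 - t) *\<^sub>R (f s1 - f t) - (s1 - t) *\<^sub>R (f s2 - f t) =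
        (s2 - t) *\<^sub>R (f s1 - f t - (s1 - t) *\<^sub>R d) - (s1 - t) *\<^sub>R (f s2 - f t - (s2 - t) *\<^sub>R d)"
        by (simp add: algebra_simps)
      also have "norm \<dots> \<le> \<bar>s2 - t\<bar> * norm (f s1 - f t - (s1 - t) *\<^sub>R d) + \<bar>s1 - t\<bar> * norm (f s2 - f t - (s2 - t) *\<^sub>R d)"
        using norm_triangle_ineq4 by (metis norm_scaleR)
      also have "\<dots> \<le> \<bar>s2 - t\<bar> * (inverse (Suc k) / 2 * \<bar>s1 - t\<bar>) + \<bar>s1 - t\<bar> * (inverse (Suc k) / 2 * \<bar>s2 - t\<bar>)"
        using s n by (intro add_mono mult_left_mono \<delta>(2)) auto
      also have "\<dots> = inverse (Suc k) * \<bar>s1 - t\<bar> * \<bar>s2 - t\<bar>"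
        by simp
      finally show "norm ((s2 - t) *\<^sub>R (f s1 - f t) - (s1 - t) *\<^sub>R (f s2 - f t)) \<le> inverse (Suc k) * \<bar>s1 - t\<bar> * \<bar>s2 - t\<bar>" .
    qed
  qed
next
  assume C: ?C
  define q where "q s = (f s - f t) /\<^sub>R (s - t)" for s
  have q: "\<exists>\<delta>>0. \<forall>s1\<in>S - {t}. \<forall>s2\<in>S - {t}. \<bar>s1 - t\<bar> < \<delta> \<longrightarrow> \<bar>s2 - t\<bar> < \<delta> \<longrightarrow> norm (q s1 - q s2) < \<epsilon>"
    if e: "\<epsilon> > 0" for \<epsilon>
  proof -
    obtain k where k: "inverse (real (Suc k)) < \<epsilon>"
      using reals_Archimedean[OF e] by blast
    obtain n where n: "\<And>s1 s2. s1 \<in> S \<Longrightarrow> s2 \<in> S \<Longrightarrow> \<bar>s1 - t\<bar> < inverse (Suc n) \<Longrightarrow> \<bar>s2 - t\<bar> < inverse (Suc n) \<Longrightarrow>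
      norm ((s2 - t) *\<^sub>R (f s1 - f t) - (s1 - t) *\<^sub>R (f s2 - f t)) \<le> inverse (Suc k) * \<bar>s1 - t\<bar> * \<bar>s2 - t\<bar>"
      using C by blast
    show ?thesis
    proof (intro exI[of _ "inverse (Suc n)"] conjI ballI impI)
      fix s1 s2 assume s: "s1 \<in> S - {t}" "s2 \<in> S - {t}" "\<bar>s1 - t\<bar> < inverse (Suc n)" "\<bar>s2 - t\<bar> < inverse (Suc n)"
      then have nz: "s1 - t \<noteq> 0" "s2 - t \<noteq> 0" by auto
      have "q s1 - q s2 = ((s2 - t) *\<^sub>R (f s1 - f t) - (s1 - t) *\<^sub>R (f s2 - f t)) /\<^sub>R ((s1 - t) * (s2 - t))"
        unfolding q_def by (rule scaleR_inverse_diff[OF nz])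
      also have "norm \<dots> = norm ((s2 - t) *\<^sub>R (f s1 - f t) - (s1 - t) *\<^sub>R (f s2 - f t)) / (\<bar>s1 - t\<bar> * \<bar>s2 - t\<bar>)"
        by (simp add: divide_inverse mult.commute abs_mult)
      also have "\<dots> \<le> inverse (Suc k)"
        using n[of s1 s2] s nz by (simp add: divide_le_eq mult.assoc)
      finally show "norm (q s1 - q s2) < \<epsilon>"
        using k by simp
    qed simp
  qed
  have close: "\<exists>m. \<forall>n\<ge>m. \<bar>\<sigma> n - t\<bar> < \<delta>" if "\<delta> > 0" for \<delta>
    using LIMSEQ_D[OF \<sigma>(1) that] by (simp add: real_norm_def)
  have "Cauchy (\<lambda>n. q (\<sigma> n))"
  proof (rule CauchyI)
    fix \<epsilon> :: real assume "\<epsilon> > 0"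
    obtain \<delta> where \<delta>: "\<delta> > 0" "\<And>s1 s2. s1 \<in> S - {t} \<Longrightarrow> s2 \<in> S - {t} \<Longrightarrow> \<bar>s1 - t\<bar> < \<delta> \<Longrightarrow> \<bar>s2 - t\<bar> < \<delta> \<Longrightarrow>
       norm (q s1 - q s2) < \<epsilon>"
      using q[OF \<open>\<epsilon> > 0\<close>] by blast
    then show "\<exists>M. \<forall>m\<ge>M. \<forall>n\<ge>M. norm (q (\<sigma> m) - q (\<sigma> n)) < \<epsilon>"
      using close[OF \<delta>(1)] \<sigma>(2,3) by (metis DiffI singletonD)
  qed
  then obtain d where d: "(\<lambda>n. q (\<sigma> n)) \<longlonglongrightarrow> d"
    using Cauchy_convergent convergent_def by blast
  have "(f has_vector_derivative d) (at t within S)"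
    unfolding has_vector_derivative_within_alt
  proof (intro allI impI)
    fix \<epsilon> :: real assume "\<epsilon> > 0"
    obtain \<delta> where \<delta>: "\<delta> > 0" "\<And>s1 s2. s1 \<in> S - {t} \<Longrightarrow> s2 \<in> S - {t} \<Longrightarrow> \<bar>s1 - t\<bar> < \<delta> \<Longrightarrow> \<bar>s2 - t\<bar> < \<delta> \<Longrightarrow>
       norm (q s1 - q s2) < \<epsilon>"
      using q[OF \<open>\<epsilon> > 0\<close>] by blast
    have "norm (f s - f t - (s - t) *\<^sub>R d) \<le> \<epsilon> * \<bar>s - t\<bar>" if s: "s \<in> S" "\<bar>s - t\<bar> < \<delta>" for s
    proof (cases "s = t")
      case False
      \<comment> \<open>One of the two points in the Cauchy bound is sent to \<open>t\<close> along
        \<open>\<sigma>\<close> while \<open>s\<close> stays fixed.\<close>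
      have "(\<lambda>n. norm (q s - q (\<sigma> n))) \<longlonglongrightarrow> norm (q s - d)"
        by (intro tendsto_intros d)
      moreover have "\<exists>m. \<forall>n\<ge>m. norm (q s - q (\<sigma> n)) \<le> \<epsilon>"
      proof -
        obtain m where m: "\<And>n. n \<ge> m \<Longrightarrow> \<bar>\<sigma> n - t\<bar> < \<delta>"
          using close[OF \<delta>(1)] by blast
        have "norm (q s - q (\<sigma> n)) \<le> \<epsilon>" if "n \<ge> m" for n
          using \<delta>(2)[of s "\<sigma> n"] m[OF that] s False \<sigma>(2,3)[of n] by auto
        then show ?thesis by blast
      qed
      ultimately have le: "norm (q s - d) \<le> \<epsilon>"
        by (rule LIMSEQ_le_const2)
      have "f s - f t - (s - t) *\<^sub>R d = (s - t) *\<^sub>R (q s - d)"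
        using False by (simp add: q_def scaleR_diff_right)
      also have "norm \<dots> = norm (q s - d) * \<bar>s - t\<bar>"
        by simp
      also have "\<dots> \<le> \<epsilon> * \<bar>s - t\<bar>"
        by (intro mult_right_mono le) simp
      finally show ?thesis .
    qed simp
    with \<delta>(1) show "\<exists>\<delta>>0. \<forall>s\<in>S. \<bar>s - t\<bar> < \<delta> \<longrightarrow> norm (f s - f t - (s - t) *\<^sub>R d) \<le> \<epsilon> * \<bar>s - t\<bar>"
      by blast
  qed
  then show "f differentiable (at t within S)"
    by (auto simp: differentiable_def has_vector_derivative_def)
qed

text \<open>\<open>vector_derivative\<close> is a Hilbert choice, and without a derivative the
  predicate chosen from is constantly false. The default value is therefore the same for all
  \<open>x\<close> and \<open>t\<close>, so it does no harm to measurability.\<close>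

lemma velocity_not_differentiable:
  assumes "\<not> x differentiable (at t within {0..T})"
  shows "velocity T x t = (SOME v. False)"
proof -
  have "(\<lambda>v. (x has_vector_derivative v) (at t within {0..T})) = (\<lambda>v. False)"
    using assms by (auto simp: differentiable_def has_vector_derivative_def)
  then show ?thesis
    by (simp add: velocity_def vector_derivative_def)
qed

text \<open>The Cauchy criterion, multiplied out, writes the set of pairs \<open>(t, a)\<close> at which \<open>X a\<close> is
  differentiable as a countable intersection of countable unions of closed sets, uncountably
  many \<open>s1\<close>, \<open>s2\<close> notwithstanding. Off this set \<open>velocity\<close> is the constant \<open>SOME v. False\<close>.\<close>

lemma borel_measurable_velocity:
  fixes X :: "'b::{metric_space, second_countable_topology} \<Rightarrow> real \<Rightarrow> 'a::euclidean_space"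
  assumes "T > 0" and cont: "continuous_on ({0..T} \<times> UNIV) (\<lambda>(t, a). X a t)"
    and sets: "sets M = sets borel"
  shows "(\<lambda>z. velocity T (X (snd z)) (fst z)) \<in> borel_measurable (lebesgue_on {0..T} \<Otimes>\<^sub>M M)"
proof -
  \<comment> \<open>Clamping the time to \<open>{0..T}\<close> extends the family continuously to
    all of the product, so that closedness and Borel measurability can be argued there.\<close>
  define Y where "Y z = X (snd z) (max 0 (min T (fst z)))" for z :: "real \<times> 'b"
  have contY: "continuous_on UNIV Y"
    unfolding Y_def using \<open>T > 0\<close>
    by (intro continuous_on_compose2[OF cont, of UNIV "\<lambda>z. (max 0 (min T (fst z)), snd z)", unfolded prod.case]
        continuous_intros) auto
  have contY2: "continuous_on UNIV (\<lambda>z. Y (s, snd z))" for s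
    by (intro continuous_on_compose2[OF contY] continuous_intros) auto
  have YX: "Y (t, a) = X a t" if "t \<in> {0..T}" for t a
    using that by (simp add: Y_def)
  \<comment> \<open>The Cauchy implications are written as disjunctions: negating the strict
    premises gives non-strict inequalities, so every set in the intersection is closed.\<close>
  define A where "A k n = (\<Inter>s1\<in>{0..T}. \<Inter>s2\<in>{0..T}.
     {z. inverse (Suc n) \<le> \<bar>s1 - fst z\<bar> \<or> inverse (Suc n) \<le> \<bar>s2 - fst z\<bar> \<or>
      norm ((s2 - fst z) *\<^sub>R (Y (s1, snd z) - Y z) - (s1 - fst z) *\<^sub>R (Y (s2, snd z) - Y z))
        \<le> inverse (Suc k) * \<bar>s1 - fst z\<bar> * \<bar>s2 - fst z\<bar>})" for k n :: nat
  have "closed (A k n)" for k n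
    unfolding A_def
    by (intro closed_INT ballI closed_Collect_disj closed_Collect_le continuous_intros contY contY2)
  then have A: "A k n \<in> sets borel" for k n
    by (rule borel_closed)
  define D where "D = (\<Inter>k. \<Union>n. A k n)"
  have D: "D \<in> sets borel"
    unfolding D_def using A by (intro sets.countable_INT'' sets.countable_UN) auto
  \<comment> \<open>The step points right in the left half of the interval and left in the right
    half. Its length is positive and at most \<open>T / 2\<close>, so \<open>\<sigma> n t\<close>
    stays in \<open>{0..T}\<close> and never equals \<open>t\<close>.\<close>
  define \<sigma> where "\<sigma> n t = (if t \<le> T / 2 then t + T / 2 * inverse (Suc n) else t - T / 2 * inverse (Suc n))"
    for n :: nat and t :: real
  have \<sigma>: "(\<lambda>n. \<sigma> n t) \<longlonglongrightarrow> t" "\<And>n. \<sigma> n t \<in> {0..T}" "\<And>n. \<sigma> n t \<noteq> t" if t: "t \<in> {0..T}" for t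
  proof -
    have *: "(\<lambda>n. T / 2 * inverse (Suc n)) \<longlonglongrightarrow> 0"
      using tendsto_mult[OF tendsto_const LIMSEQ_inverse_real_of_nat, of "T / 2"] by simp
    have "(\<lambda>n. t + T / 2 * inverse (Suc n)) \<longlonglongrightarrow> t + 0" "(\<lambda>n. t - T / 2 * inverse (Suc n)) \<longlonglongrightarrow> t - 0"
      by (intro tendsto_intros *)+
    then show "(\<lambda>n. \<sigma> n t) \<longlonglongrightarrow> t" unfolding \<sigma>_def by (cases "t \<le> T / 2") auto
    show "\<sigma> n t \<in> {0..T}" "\<sigma> n t \<noteq> t" for n
    proof -
      define w where "w = T / 2 * inverse (Suc n)"
      have "w \<le> T / 2 * 1" "0 < w"
        using \<open>T > 0\<close> unfolding w_def by (intro mult_left_mono mult_pos_pos; simp add: inverse_eq_divide)+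
      then show "\<sigma> n t \<in> {0..T}" "\<sigma> n t \<noteq> t"
        using t unfolding \<sigma>_def w_def[symmetric] by auto
    qed
  qed
  have D_iff: "(t, a) \<in> D \<longleftrightarrow> X a differentiable (at t within {0..T})" if t: "t \<in> {0..T}" for t a
  proof -
    have "(t, a) \<in> A k n \<longleftrightarrow> (\<forall>s1\<in>{0..T}. \<forall>s2\<in>{0..T}.
      \<bar>s1 - t\<bar> < inverse (Suc n) \<longrightarrow> \<bar>s2 - t\<bar> < inverse (Suc n) \<longrightarrow>
      norm ((s2 - t) *\<^sub>R (X a s1 - X a t) - (s1 - t) *\<^sub>R (X a s2 - X a t))
        \<le> inverse (Suc k) * \<bar>s1 - t\<bar> * \<bar>s2 - t\<bar>)" for k n
      unfolding A_def INT_iff mem_Collect_eq fst_conv snd_conv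
      by (intro ball_cong refl) (auto simp: YX[OF t] YX not_less[symmetric] simp del: of_nat_Suc)
    then show ?thesis
      unfolding differentiable_within_iff_Cauchy[OF \<sigma>[OF t]] D_def
      by (simp only: INT_iff UN_iff UNIV_I simp_thms Ball_def Bex_def)
  qed
  define q where "q n z = (Y (\<sigma> n (fst z), snd z) - Y z) /\<^sub>R (\<sigma> n (fst z) - fst z)" for n z
  \<comment> \<open>A Borel function on the whole product that agrees with the velocity whenever the
    time lies in \<open>{0..T}\<close>: a limit of difference quotients on \<open>D\<close>, the
    default value elsewhere.\<close>
  define F where "F z = (if z \<in> D then lim (\<lambda>n. q n z) else (SOME v. False))" for z
  have Y: "Y \<in> borel_measurable borel"
    by (rule borel_measurable_continuous_onI[OF contY])
  have fst_snd: "fst \<in> borel_measurable (borel :: (real \<times> 'b) measure)" "snd \<in> borel_measurable (borel :: (real \<times> 'b) measure)"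
    by (intro borel_measurable_continuous_onI continuous_intros)+
  have \<sigma>m: "(\<lambda>z. \<sigma> n (fst z)) \<in> borel_measurable (borel :: (real \<times> 'b) measure)" for n
    unfolding \<sigma>_def using fst_snd(1) by measurable
  have "(\<lambda>z. Y (\<sigma> n (fst z), snd z)) \<in> borel_measurable borel" for n
    by (rule measurable_compose[OF borel_measurable_Pair[OF \<sigma>m fst_snd(2)] Y])
  then have "q n \<in> borel_measurable borel" for n
    unfolding q_def using Y \<sigma>m[of n] fst_snd(1)
    by (intro borel_measurable_scaleR borel_measurable_diff borel_measurable_inverse) auto
  then have F: "F \<in> borel_measurable borel"
    unfolding F_def using D by (intro measurable_If borel_measurable_lim_metric) auto
  have "(\<lambda>z. (fst z, snd z)) \<in> measurable (lebesgue_on {0..T} \<Otimes>\<^sub>M M) (borel :: (real \<times> 'b) measure)"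
  proof (rule borel_measurable_Pair)
    have "(\<lambda>t. t) \<in> borel_measurable (lebesgue_on {0..T})"
      by (rule continuous_imp_measurable_on_sets_lebesgue) (auto intro: continuous_intros)
    then show "fst \<in> borel_measurable (lebesgue_on {0..T} \<Otimes>\<^sub>M M)"
      using measurable_compose[OF measurable_fst] by blast
    have "(\<lambda>a. a) \<in> measurable M (borel :: 'b measure)"
      using sets by (simp add: measurable_ident_sets)
    then show "snd \<in> borel_measurable (lebesgue_on {0..T} \<Otimes>\<^sub>M M)"
      using measurable_compose[OF measurable_snd] by blast
  qed
  then have "(\<lambda>z. F (fst z, snd z)) \<in> borel_measurable (lebesgue_on {0..T} \<Otimes>\<^sub>M M)"
    by (rule measurable_compose[OF _ F])
  moreover have "velocity T (X (snd z)) (fst z) = F (fst z, snd z)"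
    if "z \<in> space (lebesgue_on {0..T} \<Otimes>\<^sub>M M)" for z
  proof -
    obtain t a where z: "z = (t, a)" by (cases z)
    have t: "t \<in> {0..T}" using that by (auto simp: z space_pair_measure)
    show ?thesis
    proof (cases "X a differentiable (at t within {0..T})")
      case True
      then have "(X a has_vector_derivative velocity T (X a) t) (at t within {0..T})"
        unfolding velocity_def by (simp add: vector_derivative_works[symmetric])
      from has_vector_derivative_difference_quotient[OF this \<sigma>[OF t]]
      have "(\<lambda>n. q n (t, a)) \<longlonglongrightarrow> velocity T (X a) t"
        using t \<sigma>(2)[OF t] by (simp add: q_def YX)
      then show ?thesis
        using True D_iff[OF t] by (simp add: z F_def limI)
    next
      case False
      then show ?thesis
        using D_iff[OF t] by (simp add: z F_def velocity_not_differentiable)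
    qed
  qed
  ultimately show ?thesis
    by (subst measurable_cong)
qed

section \<open>Monotonicity of the error map\<close>

context convex_lagrangian
begin

text \<open>The mean of 1 and the contraction factor \<open>2 * M\<^sup>2 / c\<^sup>2\<close>; the
  mean arises from bounding an inner product by half the sum of the squares.\<close>

definition defect :: real where "defect = (1 + 2 * M\<^sup>2 / c\<^sup>2) / 2"

text \<open>The bound is on the integral of \<open>norm (\<Phi> t)\<close> and does not depend on
  the initial point \<open>a\<close>: Fubini's theorem needs absolute integrability jointly in
  \<open>a\<close> and \<open>t\<close>.\<close>

lemma velocity_diff_inner_bound:
  assumes Q: "Q0 \<in> L2 T" "Q1 \<in> L2 T"
    and x: "EL_solution T L g a Q0 x0" "EL_solution T L g a Q1 x1"
  defines "\<Phi> \<equiv> \<lambda>t. (velocity T x1 t - velocity T x0 t) \<bullet> (Q1 t - Q0 t)"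
  shows "integrable (lebesgue_on {0..T}) \<Phi>"
    and "(LINT t | lebesgue_on {0..T}. norm (\<Phi> t)) \<le> defect * (L2_norm T (\<lambda>t. Q1 t - Q0 t))\<^sup>2"
proof -
  let ?S = "lebesgue_on {0..T}"
  obtain p0 where t0: "EL_trajectory T L g Q0 x0 p0" using EL_solution_trajectoryE[OF x(1)] .
  obtain p1 where t1: "EL_trajectory T L g Q1 x1 p1" using EL_solution_trajectoryE[OF x(2)] .
  define E where "E t = (norm (x1 t - x0 t))\<^sup>2 + (norm (velocity T x1 t - velocity T x0 t))\<^sup>2" for t
  define R where "R = (L2_norm T (\<lambda>t. Q1 t - Q0 t))\<^sup>2"
  have "x0 0 = a" "x1 0 = a"
    using x by (auto simp: EL_solution_def)
  then have EI: "integrable ?S E" "c / 2 * (LINT t | ?S. E t) \<le> M\<^sup>2 / c * R"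
    using EL_energy_estimate[OF t0 t1 Q] by (simp_all add: E_def[abs_def] R_def)
  have dQ: "(\<lambda>t. Q1 t - Q0 t) \<in> L2 T"
    using Q by (intro L2_diff)
  then have Qi: "integrable ?S (\<lambda>t. (norm (Q1 t - Q0 t))\<^sup>2)"
    by (auto simp: L2_def)
  have R: "(LINT t | ?S. (norm (Q1 t - Q0 t))\<^sup>2) = R"
    by (simp add: R_def L2_norm_def L2_inner_def power2_norm_eq_inner)
  have bound: "norm (\<Phi> t) \<le> (E t + (norm (Q1 t - Q0 t))\<^sup>2) / 2" for t
  proof -
    have "norm (\<Phi> t) \<le> norm (velocity T x1 t - velocity T x0 t) * norm (Q1 t - Q0 t)"
      unfolding \<Phi>_def by (simp add: Cauchy_Schwarz_ineq2)
    also have "\<dots> \<le> ((norm (velocity T x1 t - velocity T x0 t))\<^sup>2 + (norm (Q1 t - Q0 t))\<^sup>2) / 2"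
      using sum_squares_bound[of "norm (velocity T x1 t - velocity T x0 t)" "norm (Q1 t - Q0 t)"] by simp
    also have "\<dots> \<le> (E t + (norm (Q1 t - Q0 t))\<^sup>2) / 2"
      by (simp add: E_def)
    finally show ?thesis .
  qed
  have B: "integrable ?S (\<lambda>t. (E t + (norm (Q1 t - Q0 t))\<^sup>2) / 2)"
    using EI(1) Qi by simp
  show \<Phi>: "integrable ?S \<Phi>"
  proof (rule Bochner_Integration.integrable_bound[OF B])
    show "\<Phi> \<in> borel_measurable ?S"
      unfolding \<Phi>_def using EL_trajectory_velocity_measurable[OF t0] EL_trajectory_velocity_measurable[OF t1] T_pos Q
      by (intro borel_measurable_inner borel_measurable_diff) (auto simp: L2_def)
    show "AE t in ?S. norm (\<Phi> t) \<le> norm ((E t + (norm (Q1 t - Q0 t))\<^sup>2) / 2)"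
      using bound by (intro AE_I2) (metis abs_ge_self order_trans real_norm_def)
  qed
  have "(LINT t | ?S. norm (\<Phi> t)) \<le> (LINT t | ?S. (E t + (norm (Q1 t - Q0 t))\<^sup>2) / 2)"
    by (intro integral_mono integrable_norm \<Phi> B bound)
  also have "\<dots> = ((LINT t | ?S. E t) + R) / 2"
    using EI(1) Qi by (simp add: R)
  also have "(LINT t | ?S. E t) \<le> 2 * M\<^sup>2 / c\<^sup>2 * R"
    using EI(2) c_pos by (simp add: field_simps power2_eq_square)
  then have "((LINT t | ?S. E t) + R) / 2 \<le> (2 * M\<^sup>2 / c\<^sup>2 * R + R) / 2"
    by simp
  also have "\<dots> = defect * R"
    by (simp add: defect_def algebra_simps add_divide_distrib)
  finally show "(LINT t | ?S. norm (\<Phi> t)) \<le> defect * (L2_norm T (\<lambda>t. Q1 t - Q0 t))\<^sup>2"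
    by (simp add: R_def)
qed

text \<open>The inner product equals the squared norm of \<open>Q1 - Q0\<close> plus the time
  integral of the average of \<open>\<Phi> a t\<close> over \<open>a\<close>. After exchanging the
  integrals, each inner one is at least \<open>- (defect * R)\<close>, and averaging over a
  probability measure preserves this bound.\<close>

lemma error_map_monotone:
  assumes m0: "prob_space m\<^sub>0" "sets m\<^sub>0 = sets borel"
    and wd: "error_map_well_defined T L g m\<^sub>0"
    and Q: "Q0 \<in> L2 T" "Q1 \<in> L2 T"
  shows "(1 - defect) * (L2_norm T (\<lambda>t. Q1 t - Q0 t))\<^sup>2 \<le>
    L2_inner T (\<lambda>t. error_map T L g m\<^sub>0 Q1 t - error_map T L g m\<^sub>0 Q0 t) (\<lambda>t. Q1 t - Q0 t)"
proof -
  let ?S = "lebesgue_on {0..T}"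
  interpret m0: prob_space m\<^sub>0 by fact
  interpret S: finite_measure ?S
    by (rule finite_measure_lebesgue_on) simp
  interpret P: pair_sigma_finite m\<^sub>0 ?S ..
  define R where "R = (L2_norm T (\<lambda>t. Q1 t - Q0 t))\<^sup>2"
  define V where "V Q a t = velocity T (EL_curve T L g a Q) t" for Q a t
  have ex: "\<exists>x. EL_solution T L g a Q x" if "Q \<in> L2 T" for Q a
    using wd that unfolding error_map_well_defined_def by blast
  have sol: "EL_solution T L g a Q (EL_curve T L g a Q)" if "Q \<in> L2 T" for Q a
    using EL_curve_solution[OF that ex[OF that]] .
  have Vm: "(\<lambda>(a, t). V Q a t) \<in> borel_measurable (m\<^sub>0 \<Otimes>\<^sub>M ?S)" if "Q \<in> L2 T" for Q
  proof -
    have "(\<lambda>z. velocity T (EL_curve T L g (snd z) Q) (fst z)) \<in> borel_measurable (?S \<Otimes>\<^sub>M m\<^sub>0)"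
      using EL_solutions_continuous[OF that sol[OF that]] T_pos m0(2) by (intro borel_measurable_velocity)
    from measurable_pair_swap[OF this] show ?thesis
      by (simp add: V_def split_def)
  qed
  have dQ: "(\<lambda>t. Q1 t - Q0 t) \<in> L2 T"
    using Q by (intro L2_diff)
  then have Qi: "integrable ?S (\<lambda>t. (norm (Q1 t - Q0 t))\<^sup>2)"
    by (auto simp: L2_def)
  have Qm: "Q0 \<in> borel_measurable ?S" "Q1 \<in> borel_measurable ?S"
    using Q by (auto simp: L2_def)
  have R: "(LINT t | ?S. (norm (Q1 t - Q0 t))\<^sup>2) = R"
    by (simp add: R_def L2_norm_def L2_inner_def power2_norm_eq_inner)
  define \<Phi> where "\<Phi> a t = (V Q1 a t - V Q0 a t) \<bullet> (Q1 t - Q0 t)" for a t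
  have \<Phi>m: "(\<lambda>(a, t). \<Phi> a t) \<in> borel_measurable (m\<^sub>0 \<Otimes>\<^sub>M ?S)"
    using Vm[OF Q(1)] Vm[OF Q(2)] measurable_compose[OF measurable_snd Qm(1), of m\<^sub>0]
      measurable_compose[OF measurable_snd Qm(2), of m\<^sub>0]
    unfolding \<Phi>_def split_def by (intro borel_measurable_inner borel_measurable_diff) auto
  have \<Phi>: "integrable ?S (\<Phi> a)" "(LINT t | ?S. norm (\<Phi> a t)) \<le> defect * R" for a
    using velocity_diff_inner_bound[OF Q sol[OF Q(1)] sol[OF Q(2)], of a]
    unfolding \<Phi>_def[abs_def] V_def R_def by auto
  \<comment> \<open>The time integrals of \<open>norm (\<Phi> a t)\<close> are bounded uniformly in
    \<open>a\<close>, which suffices for integrability over the probability measure.\<close>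
  have \<Phi>i: "integrable (m\<^sub>0 \<Otimes>\<^sub>M ?S) (\<lambda>(a, t). \<Phi> a t)"
  proof (rule P.Fubini_integrable[OF \<Phi>m])
    have "(\<lambda>a. LINT t | ?S. norm (\<Phi> a t)) \<in> borel_measurable m\<^sub>0"
      using \<Phi>m by (intro S.borel_measurable_lebesgue_integral) (auto simp: split_def)
    then show "integrable m\<^sub>0 (\<lambda>a. LINT t | ?S. norm (case (a, t) of (a, t) \<Rightarrow> \<Phi> a t))"
      using \<Phi>(2) by (intro m0.integrable_const_bound[of _ "defect * R"]) auto
    show "AE a in m\<^sub>0. integrable ?S (\<lambda>t. case (a, t) of (a, t) \<Rightarrow> \<Phi> a t)"
      using \<Phi>(1) by simp
  qed
  have int\<Phi>: "integrable ?S (\<lambda>t. LINT a | m\<^sub>0. \<Phi> a t)"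
    using P.integrable_snd[OF \<Phi>i] .
  have ae: "AE t in ?S. (error_map T L g m\<^sub>0 Q1 t - error_map T L g m\<^sub>0 Q0 t) \<bullet> (Q1 t - Q0 t)
      = (norm (Q1 t - Q0 t))\<^sup>2 + (LINT a | m\<^sub>0. \<Phi> a t)"
  proof -
    \<comment> \<open>The average of the difference splits into the difference of the averages only
      where both velocities are integrable in \<open>a\<close>; well-definedness of the error map
      provides this for almost every time.\<close>
    have "AE t in ?S. integrable m\<^sub>0 (\<lambda>a. V Q1 a t)" "AE t in ?S. integrable m\<^sub>0 (\<lambda>a. V Q0 a t)"
      using wd Q unfolding error_map_well_defined_def V_def by blast+
    then show ?thesis
    proof eventually_elim
      case (elim t)
      then have "(LINT a | m\<^sub>0. \<Phi> a t) = ((LINT a | m\<^sub>0. V Q1 a t) - (LINT a | m\<^sub>0. V Q0 a t)) \<bullet> (Q1 t - Q0 t)"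
        unfolding \<Phi>_def by simp
      then show ?case
        unfolding error_map_def V_def power2_norm_eq_inner by (simp add: algebra_simps)
    qed
  qed
  have em: "error_map T L g m\<^sub>0 Q0 \<in> borel_measurable ?S" "error_map T L g m\<^sub>0 Q1 \<in> borel_measurable ?S"
    using wd Q unfolding error_map_well_defined_def L2_def by auto
  have "L2_inner T (\<lambda>t. error_map T L g m\<^sub>0 Q1 t - error_map T L g m\<^sub>0 Q0 t) (\<lambda>t. Q1 t - Q0 t)
      = (LINT t | ?S. (norm (Q1 t - Q0 t))\<^sup>2 + (LINT a | m\<^sub>0. \<Phi> a t))"
    unfolding L2_inner_def using em Qm Qi int\<Phi>
    by (intro integral_cong_AE ae borel_measurable_inner borel_measurable_diff borel_measurable_add) auto
  also have "\<dots> = R + (LINT t | ?S. LINT a | m\<^sub>0. \<Phi> a t)"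
    using Qi int\<Phi> by (simp add: R)
  also have "(LINT t | ?S. LINT a | m\<^sub>0. \<Phi> a t) = (LINT a | m\<^sub>0. LINT t | ?S. \<Phi> a t)"
    by (rule P.Fubini_integral[OF \<Phi>i])
  finally have eq: "L2_inner T (\<lambda>t. error_map T L g m\<^sub>0 Q1 t - error_map T L g m\<^sub>0 Q0 t) (\<lambda>t. Q1 t - Q0 t)
      = R + (LINT a | m\<^sub>0. LINT t | ?S. \<Phi> a t)" .
  have "- (defect * R) \<le> (LINT t | ?S. \<Phi> a t)" for a
    using integral_norm_bound[of ?S "\<Phi> a"] \<Phi>(2)[of a] unfolding real_norm_def by linarith
  then have "- (defect * R) \<le> (LINT a | m\<^sub>0. LINT t | ?S. \<Phi> a t)"
    using P.integrable_fst[OF \<Phi>i] by (intro m0.integral_ge_const) auto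
  then show ?thesis
    unfolding eq R_def[symmetric] by (simp add: algebra_simps)
qed

end

theorem theorem2p12:
  fixes T c :: real
    and L :: "'d::finite lagrangian"
    and g :: "real^'d \<Rightarrow> real"
    and m\<^sub>0 :: "(real^'d) measure"
  assumes "T > 0"
    and "prob_space m\<^sub>0" and "sets m\<^sub>0 = sets borel"
    and "C2 (\<lambda>(x, v, Q). L x v Q)"
    and "\<exists>x v Q. D_x L x v Q \<noteq> 0"
    and "c > 0"
    and "\<And>x v Q h. h \<bullet> D2_xv L x v Q h \<ge> c * (h \<bullet> h)"
    and "ereal (c\<^sup>2) > 2 * (max (Linf_norm (D2_vQ L)) (Linf_norm (D2_xQ L)))\<^sup>2"
    and "C2 g"
    and "\<And>x h. h \<bullet> hessian g x h \<ge> 0"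
    and "error_map_well_defined T L g m\<^sub>0"
  shows "\<exists>\<delta><1. \<forall>Q\<^sub>0\<in>L2 T. \<forall>Q\<^sub>1\<in>L2 T.
           L2_inner T (\<lambda>t. error_map T L g m\<^sub>0 Q\<^sub>1 t - error_map T L g m\<^sub>0 Q\<^sub>0 t) (\<lambda>t. Q\<^sub>1 t - Q\<^sub>0 t)
             \<ge> (1 - \<delta>) * (L2_norm T (\<lambda>t. Q\<^sub>1 t - Q\<^sub>0 t))\<^sup>2"
proof -
  obtain M where M: "M \<ge> 0" "2 * M\<^sup>2 < c\<^sup>2"
    "\<And>x v P0 P1. norm (D_x L x v P1 - D_x L x v P0) \<le> M * norm (P1 - P0)"
    "\<And>x v P0 P1. norm (D_v L x v P1 - D_v L x v P0) \<le> M * norm (P1 - P0)"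
    "\<And>x0 v0 x1 v1 P. (D_x L x1 v1 P - D_x L x0 v0 P) \<bullet> (x1 - x0)
       + (D_v L x1 v1 P - D_v L x0 v0 P) \<bullet> (v1 - v0)
       \<ge> c * ((norm (x1 - x0))\<^sup>2 + (norm (v1 - v0))\<^sup>2)"
    by (rule lagrangian_bounds[OF assms(4,6,7,8)]) blast
  interpret convex_lagrangian T c M L g
  proof
    \<comment> \<open>Convexity of \<open>g\<close> is the case of constant 0 in the strong
      monotonicity inequality for gradients.\<close>
    show "0 \<le> (gradient g x1 - gradient g x0) \<bullet> (x1 - x0)" for x1 x0
      using inner_gradient_diff_ge[of g 0 x1 x0, OF C2_gradient(2)[OF assms(9)]] assms(10) by simp
  qed (fact assms(1,6) M)+
  \<comment> \<open>This is the smallness condition \<open>2 * M\<^sup>2 < c\<^sup>2\<close> in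
    another form.\<close>
  have "defect < 1"
    using M(2) c_pos by (simp add: defect_def divide_less_eq)
  with error_map_monotone[OF assms(2,3,11)] show ?thesis
    by blast
qed

end
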